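(* Let $p>2$, $N\ge 1$, $\delta\in(0,1)$, let $B_1\subset\mathbb{R}^N$ be the open unit ball centred at the origin, and let $\frac{p}{p-2}\le\theta_1<\theta_2<\infty$. For $\theta>0$ and $\lambda>0$ define, with $r=|x|$, $$u_\theta(x)=1-r^\theta,\qquad f_\theta(x)=\big((p-1)(\theta-1)-1+N\big)\theta^{p-1}r^{(p-1)(\theta-1)-1}-\lambda(1-r^\theta)^{-\delta}.$$ Then for all sufficiently large $\lambda$ the following hold: for $\theta\in\{\theta_1,\theta_2\}$, $u_\theta$ is a positive radially decreasing solution of $-\Delta_p u_\theta-\lambda u_\theta^{-\delta}=f_\theta$ in $B_1$, $u_\theta=0$ on $\partial B_1$, with $f_\theta\in C(B_1)$ radial; $f_{\theta_1}\le f_{\theta_2}$ in $B_1$ and $f_{\theta_1}\not\equiv f_{\theta_2}$; and $u_{\theta_1}<u_{\theta_2}$ in $B_1\setminus\{0\}$ but $u_{\theta_1}(0)=u_{\theta_2}(0)=1$. Consequently, the strong comparison principle (that $u<v$ everywhere in the ball whenever $u,v$ are positive radially decreasing solutions of $-\Delta_p u-\lambda u^{-\delta}=f$, $-\Delta_p v-\lambda v^{-\delta}=g$ with zero boundary values and $f\le g$, $f\not\equiv g$ continuous radial) fails when $p>2$.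
   Context: $\Delta_p u=\mathrm{div}(|\nabla u|^{p-2}\nabla u)$ is the $p$-Laplacian; solutions are understood in the weak sense. A function is radially decreasing if it depends only on $r=|x|$ and is decreasing in $r$. *)

theory Defs
  imports "HOL-Analysis.Analysis"
begin

definition grad :: "('a::euclidean_space \<Rightarrow> real) \<Rightarrow> 'a \<Rightarrow> 'a" where
  "grad f x = (\<Sum>b\<in>Basis. frechet_derivative f (at x) b *\<^sub>R b)"

primrec C_k :: "nat \<Rightarrow> ('a::euclidean_space \<Rightarrow> real) \<Rightarrow> bool" where
  "C_k 0 f \<longleftrightarrow> continuous_on UNIV f"
| "C_k (Suc k) f \<longleftrightarrow> (\<forall>x. f differentiable (at x)) \<and>
     (\<forall>b\<in>Basis. C_k k (\<lambda>x. frechet_derivative f (at x) b))"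

definition test_function :: "'a::euclidean_space set \<Rightarrow> ('a \<Rightarrow> real) \<Rightarrow> bool" where
  "test_function \<Omega> \<phi> \<longleftrightarrow> (\<forall>k. C_k k \<phi>) \<and>
     compact (closure {x. \<phi> x \<noteq> 0}) \<and> closure {x. \<phi> x \<noteq> 0} \<subseteq> \<Omega>"

definition locally_integrable_on ::
  "'a::euclidean_space set \<Rightarrow> ('a \<Rightarrow> 'b::euclidean_space) \<Rightarrow> bool" where
  "locally_integrable_on \<Omega> f \<longleftrightarrow> (\<forall>K. compact K \<and> K \<subseteq> \<Omega> \<longrightarrow> set_integrable lebesgue K f)"

definition weak_gradient ::
  "'a::euclidean_space set \<Rightarrow> ('a \<Rightarrow> real) \<Rightarrow> ('a \<Rightarrow> 'a) \<Rightarrow> bool" where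
  "weak_gradient \<Omega> u G \<longleftrightarrow> locally_integrable_on \<Omega> u \<and> locally_integrable_on \<Omega> G \<and>
     (\<forall>\<phi>. test_function \<Omega> \<phi> \<longrightarrow>
        (LINT x:\<Omega>|lebesgue. u x *\<^sub>R grad \<phi> x) = - (LINT x:\<Omega>|lebesgue. \<phi> x *\<^sub>R G x))"

definition Lp_on ::
  "real \<Rightarrow> 'a::euclidean_space set \<Rightarrow> ('a \<Rightarrow> 'b::euclidean_space) \<Rightarrow> bool" where
  "Lp_on p \<Omega> f \<longleftrightarrow> set_borel_measurable lebesgue \<Omega> f \<and>
     set_integrable lebesgue \<Omega> (\<lambda>x. norm (f x) powr p)"

text \<open>Membership of \<open>u\<close> in \<open>W\<^sub>0\<^sup>1\<^sup>,\<^sup>p(\<Omega>)\<close>, the closure of the test functions in the Sobolev norm;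
  \<open>G\<close> is the weak gradient of \<open>u\<close>, which is determined almost everywhere.\<close>

definition W0_with_gradient ::
  "real \<Rightarrow> 'a::euclidean_space set \<Rightarrow> ('a \<Rightarrow> real) \<Rightarrow> ('a \<Rightarrow> 'a) \<Rightarrow> bool" where
  "W0_with_gradient p \<Omega> u G \<longleftrightarrow>
     weak_gradient \<Omega> u G \<and> Lp_on p \<Omega> u \<and> Lp_on p \<Omega> G \<and>
     (\<exists>\<phi>::nat \<Rightarrow> 'a \<Rightarrow> real. (\<forall>n. test_function \<Omega> (\<phi> n)) \<and>
        (\<lambda>n. LINT x:\<Omega>|lebesgue. \<bar>\<phi> n x - u x\<bar> powr p) \<longlonglongrightarrow> 0 \<and>
        (\<lambda>n. LINT x:\<Omega>|lebesgue. norm (grad (\<phi> n) x - G x) powr p) \<longlonglongrightarrow> 0)"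

text \<open>Positive weak solutions of \<open>- \<Delta>\<^sub>p u - lam \<cdot> u\<^sup>-\<^sup>\<delta> = f\<close> in \<open>\<Omega>\<close>, \<open>u = 0\<close> on the boundary.
  The boundary condition is imposed both in the trace sense and pointwise, and \<open>u\<close> is the
  continuous representative, so that pointwise comparison is meaningful.\<close>

definition positive_weak_solution ::
  "real \<Rightarrow> real \<Rightarrow> real \<Rightarrow> 'a::euclidean_space set \<Rightarrow> ('a \<Rightarrow> real) \<Rightarrow> ('a \<Rightarrow> real) \<Rightarrow> bool" where
  "positive_weak_solution p \<delta> lam \<Omega> f u \<longleftrightarrow>
     continuous_on (closure \<Omega>) u \<and> (\<forall>x\<in>\<Omega>. 0 < u x) \<and> (\<forall>x\<in>frontier \<Omega>. u x = 0) \<and>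
     locally_integrable_on \<Omega> (\<lambda>x. u x powr (- \<delta>)) \<and> locally_integrable_on \<Omega> f \<and>
     (\<exists>G. W0_with_gradient p \<Omega> u G \<and>
        (\<forall>\<phi>. test_function \<Omega> \<phi> \<longrightarrow>
           (LINT x:\<Omega>|lebesgue. norm (G x) powr (p - 2) * (G x \<bullet> grad \<phi> x))
             - lam * (LINT x:\<Omega>|lebesgue. u x powr (- \<delta>) * \<phi> x)
           = (LINT x:\<Omega>|lebesgue. f x * \<phi> x)))"

definition radial_on :: "'a::euclidean_space set \<Rightarrow> ('a \<Rightarrow> real) \<Rightarrow> bool" where
  "radial_on \<Omega> f \<longleftrightarrow> (\<exists>F. \<forall>x\<in>\<Omega>. f x = F (norm x))"

text \<open>Decreasing is meant strictly. As the solutions are radially decreasing in the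
  hypotheses of the comparison principle below, its failure is thereby the stronger claim.\<close>

definition radially_decreasing_on :: "'a::euclidean_space set \<Rightarrow> ('a \<Rightarrow> real) \<Rightarrow> bool" where
  "radially_decreasing_on \<Omega> u \<longleftrightarrow>
     (\<exists>U. (\<forall>x\<in>\<Omega>. u x = U (norm x)) \<and> (\<forall>r\<in>norm ` \<Omega>. \<forall>s\<in>norm ` \<Omega>. r < s \<longrightarrow> U s < U r))"

definition strong_comparison_principle ::
  "real \<Rightarrow> real \<Rightarrow> real \<Rightarrow> 'a::euclidean_space set \<Rightarrow> bool" where
  "strong_comparison_principle p \<delta> lam \<Omega> \<longleftrightarrow>
     (\<forall>u v f g.
        continuous_on \<Omega> f \<and> radial_on \<Omega> f \<and> continuous_on \<Omega> g \<and> radial_on \<Omega> g \<and>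
        (\<forall>x\<in>\<Omega>. f x \<le> g x) \<and> (\<exists>x\<in>\<Omega>. f x \<noteq> g x) \<and>
        positive_weak_solution p \<delta> lam \<Omega> f u \<and> radially_decreasing_on \<Omega> u \<and>
        positive_weak_solution p \<delta> lam \<Omega> g v \<and> radially_decreasing_on \<Omega> v \<longrightarrow>
        (\<forall>x\<in>\<Omega>. u x < v x))"

definition u_fun :: "real \<Rightarrow> 'a::euclidean_space \<Rightarrow> real" where
  "u_fun \<theta> x = 1 - norm x powr \<theta>"

definition f_fun :: "real \<Rightarrow> real \<Rightarrow> real \<Rightarrow> real \<Rightarrow> 'a::euclidean_space \<Rightarrow> real" where
  "f_fun p \<delta> lam \<theta> x =
     ((p - 1) * (\<theta> - 1) - 1 + real DIM('a)) * \<theta> powr (p - 1) *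
       norm x powr ((p - 1) * (\<theta> - 1) - 1)
     - lam * (1 - norm x powr \<theta>) powr (- \<delta>)"

end

theory Submission
  imports Defs "HOL-Computational_Algebra.Polynomial"
begin

text \<open>Write \<open>a = (p - 1) (\<theta> - 1) - 1\<close>. The flux \<open>|\<nabla>u\<^sub>\<theta>|\<^sup>p\<^sup>-\<^sup>2 \<nabla>u\<^sub>\<theta> = - \<theta>\<^sup>p\<^sup>-\<^sup>1 |x|\<^sup>a x\<close> is of class \<open>C\<^sup>1\<close>
  because \<open>a > 1\<close>, and integrating it by parts against test functions gives the weak equation.
  Membership in \<open>W\<^sub>0\<^sup>1\<^sup>,\<^sup>p\<close> does not need mollification: with
  \<open>f\<^sub>\<epsilon> = 1 - \<epsilon> - (|x|\<^sup>2 + \<epsilon>)\<^sup>\<theta>\<^sup>/\<^sup>2\<close>, the functions \<open>f\<^sub>\<epsilon> exp (- \<epsilon> / f\<^sub>\<epsilon>)\<close>, extended by zero to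
  \<open>f\<^sub>\<epsilon> \<le> 0\<close>, are smooth with compact support in the ball, have gradients bounded by \<open>\<theta>\<close>, and
  converge to \<open>u\<^sub>\<theta>\<close> together with their gradients by dominated convergence.

  The condition \<open>\<theta>\<^sub>1 \<ge> p / (p - 2)\<close> says exactly that \<open>a\<^sub>1 \<ge> \<theta>\<^sub>1\<close>. Hence with
  \<open>s = r\<^bsup>\<theta>\<^sub>2 - \<theta>\<^sub>1\<^esup>\<close> the possible excess of the first term of \<open>f\<^sub>\<theta>\<close> for \<open>\<theta>\<^sub>1\<close> over that for \<open>\<theta>\<^sub>2\<close> is at most a
  constant times \<open>r\<^bsup>\<theta>\<^sub>1\<^esup> (1 - s)\<close>, whereas the singular terms differ in the other direction by at least
  \<open>\<lambda> \<delta> r\<^bsup>\<theta>\<^sub>1\<^esup> (1 - s)\<close>.\<close>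

section \<open>Smooth functions\<close>

text \<open>The witness \<open>H\<close> is the whole sequence of derivatives, so passing to the
  derivative is a shift of the index. The derivatives are two-sided even at points of
  \<open>S\<close>, as the chain rule on the whole space requires.\<close>

definition smooth_real_on :: "real set \<Rightarrow> (real \<Rightarrow> real) \<Rightarrow> bool" where
  "smooth_real_on S g \<longleftrightarrow>
     (\<exists>H. H 0 = g \<and> (\<forall>n. \<forall>t\<in>S. (H n has_real_derivative H (Suc n) t) (at t)))"

text \<open>Not all smooth functions, but a class rich enough for the approximations below and
  generated by rules whose derivative formulas stay inside it. The range condition in the last rule
  keeps real powers away from 0.\<close>

inductive smooth :: "('a::euclidean_space \<Rightarrow> real) \<Rightarrow> bool" where
  smooth_const: "smooth (\<lambda>x. c)"
| smooth_inner: "smooth (\<lambda>x. x \<bullet> a)"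
| smooth_add: "smooth f \<Longrightarrow> smooth g \<Longrightarrow> smooth (\<lambda>x. f x + g x)"
| smooth_mult: "smooth f \<Longrightarrow> smooth g \<Longrightarrow> smooth (\<lambda>x. f x * g x)"
| smooth_chain: "smooth_real_on S g \<Longrightarrow> smooth f \<Longrightarrow> range f \<subseteq> S \<Longrightarrow> smooth (\<lambda>x. g (f x))"

lemma smooth_real_on_derivE:
  assumes "smooth_real_on S g"
  obtains g' where "\<And>t. t \<in> S \<Longrightarrow> (g has_real_derivative g' t) (at t)" "smooth_real_on S g'"
proof -
  obtain H where H: "H 0 = g" "\<And>n t. t \<in> S \<Longrightarrow> (H n has_real_derivative H (Suc n) t) (at t)"
    using assms unfolding smooth_real_on_def by blast
  show thesis
  proof
    show "(g has_real_derivative H 1 t) (at t)" if "t \<in> S" for t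
      using H(2)[OF that, of 0] H(1) by simp
    show "smooth_real_on S (H 1)"
      unfolding smooth_real_on_def using H(2) by (intro exI[of _ "\<lambda>n. H (Suc n)"]) auto
  qed
qed

text \<open>Induction over the generation: sum, product and chain rule express each directional
  derivative through functions built by the same rules. This closure makes \<open>C_k\<close> for
  every \<open>k\<close> a plain induction.\<close>

lemma smooth_has_derivative:
  assumes "smooth f"
  shows "\<exists>D. (\<forall>x. (f has_derivative D x) (at x)) \<and> (\<forall>b. smooth (\<lambda>x. D x b))"
  using assms
proof induction
  case (smooth_const c)
  show ?case
    by (intro exI[of _ "\<lambda>x h. 0"]) (auto intro: smooth.smooth_const)
next
  case (smooth_inner a)
  have "((\<lambda>x. x \<bullet> a) has_derivative (\<lambda>h. h \<bullet> a)) (at x)" for x :: 'a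
    by (auto intro!: derivative_eq_intros)
  then show ?case
    by (intro exI[of _ "\<lambda>x h. h \<bullet> a"]) (auto intro: smooth.smooth_const)
next
  case (smooth_add f g)
  then obtain D E where
    "\<And>x. (f has_derivative D x) (at x)" "\<And>b. smooth (\<lambda>x. D x b)"
    "\<And>x. (g has_derivative E x) (at x)" "\<And>b. smooth (\<lambda>x. E x b)" by blast
  then show ?case
    by (intro exI[of _ "\<lambda>x h. D x h + E x h"])
       (auto intro: smooth.smooth_add has_derivative_add)
next
  case (smooth_mult f g)
  then obtain D E where
    "\<And>x. (f has_derivative D x) (at x)" "\<And>b. smooth (\<lambda>x. D x b)"
    "\<And>x. (g has_derivative E x) (at x)" "\<And>b. smooth (\<lambda>x. E x b)" by blast
  then show ?case
    using smooth_mult.hyps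
    by (intro exI[of _ "\<lambda>x h. f x * E x h + D x h * g x"])
       (auto intro!: smooth.smooth_add smooth.smooth_mult has_derivative_mult)
next
  case (smooth_chain S g f)
  then obtain D where D: "\<And>x. (f has_derivative D x) (at x)" "\<And>b. smooth (\<lambda>x. D x b)" by blast
  obtain g' where g': "\<And>t. t \<in> S \<Longrightarrow> (g has_real_derivative g' t) (at t)" "smooth_real_on S g'"
    using smooth_real_on_derivE[OF smooth_chain.hyps(1)] by blast
  have "((\<lambda>x. g (f x)) has_derivative (\<lambda>h. g' (f x) * D x h)) (at x)" for x
  proof -
    have "(g has_derivative (\<lambda>h. h * g' (f x))) (at (f x))"
      using g'(1)[of "f x"] smooth_chain.hyps
      by (auto simp: has_field_derivative_def mult_commute_abs)
    from has_derivative_compose[OF D(1) this] show ?thesis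
      by (simp add: mult.commute)
  qed
  moreover have "smooth (\<lambda>x. g' (f x) * D x b)" for b
    using D(2) g'(2) smooth_chain.hyps by (intro smooth.smooth_mult smooth.smooth_chain[of S g'])
  ultimately show ?case
    by (intro exI[of _ "\<lambda>x h. g' (f x) * D x h"]) auto
qed

lemma smooth_imp_C_k: "smooth f \<Longrightarrow> C_k k f"
proof (induction k arbitrary: f)
  case 0
  obtain D where "\<And>x. (f has_derivative D x) (at x)"
    using smooth_has_derivative[OF 0] by blast
  then show ?case
    by (auto intro!: continuous_at_imp_continuous_on has_derivative_continuous)
next
  case (Suc k)
  obtain D where D: "\<And>x. (f has_derivative D x) (at x)" "\<And>b. smooth (\<lambda>x. D x b)"
    using smooth_has_derivative[OF Suc.prems] by blast
  have "frechet_derivative f (at x) = D x" for x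
    using frechet_derivative_at[OF D(1)] by metis
  with D Suc.IH show ?case
    by (auto simp: differentiable_def)
qed

lemma smooth_sum: "(\<And>i. i \<in> I \<Longrightarrow> smooth (f i)) \<Longrightarrow> smooth (\<lambda>x. \<Sum>i\<in>I. f i x)"
  by (induction I rule: infinite_finite_induct) (auto intro: smooth.intros)

lemma smooth_norm_power2: "smooth (\<lambda>x::'a::euclidean_space. (norm x)\<^sup>2)"
proof -
  have "smooth (\<lambda>x::'a. \<Sum>b\<in>Basis. (x \<bullet> b) * (x \<bullet> b))"
    by (intro smooth_sum smooth.intros)
  also have "(\<lambda>x::'a. \<Sum>b\<in>Basis. (x \<bullet> b) * (x \<bullet> b)) = (\<lambda>x. (norm x)\<^sup>2)"
    by (simp add: fun_eq_iff power2_norm_eq_inner euclidean_inner[symmetric])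
  finally show ?thesis .
qed

lemma smooth_real_on_powr: "smooth_real_on {0<..} (\<lambda>t. t powr a)"
  unfolding smooth_real_on_def
\<comment> \<open>The \<open>n\<close>-th derivative carries the falling factorial of
  \<open>a\<close> as coefficient.\<close>
proof (intro exI[of _ "\<lambda>n t. (\<Prod>i<n. a - real i) * t powr (a - real n)"] conjI allI ballI)
  fix n and t :: real assume "t \<in> {0<..}"
  then have "((\<lambda>t. t powr (a - real n)) has_real_derivative (a - real n) * t powr (a - real n - 1)) (at t)"
    by (intro has_real_derivative_powr) auto
  from DERIV_cmult[OF this, of "\<Prod>i<n. a - real i"]
  show "((\<lambda>t. (\<Prod>i<n. a - real i) * t powr (a - real n)) has_real_derivative
      (\<Prod>i<Suc n. a - real i) * t powr (a - real (Suc n))) (at t)"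
    by (simp add: algebra_simps)
qed auto

text \<open>Functions of the form \<open>P (1/t) exp (-1/t)\<close>, extended by zero to \<open>t \<le> 0\<close>, are closed under
  differentiation: \<open>P\<close> is replaced by \<open>X\<^sup>2 (P - P')\<close>.\<close>

definition flat_poly :: "real poly \<Rightarrow> real \<Rightarrow> real" where
  "flat_poly P t = (if t > 0 then poly P (1 / t) * exp (- (1 / t)) else 0)"

definition flat_step :: "real poly \<Rightarrow> real poly" where
  "flat_step P = monom 1 2 * (P - pderiv P)"

lemma poly_div_exp_tendsto_0: "((\<lambda>x::real. poly P x * exp (- x)) \<longlongrightarrow> 0) at_top"
proof -
  have "((\<lambda>x::real. \<Sum>i\<le>degree P. coeff P i * (x ^ i / exp x)) \<longlongrightarrow> (\<Sum>i\<le>degree P. coeff P i * 0)) at_top"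
    by (intro tendsto_sum tendsto_mult tendsto_const tendsto_power_div_exp_0)
  then show ?thesis
    by (simp add: poly_altdef sum_divide_distrib exp_minus field_simps)
qed

lemma flat_poly_deriv: "(flat_poly P has_real_derivative flat_poly (flat_step P) t) (at t)"
proof -
  consider "t > 0" | "t < 0" | "t = 0" by linarith
  then show ?thesis
  proof cases
    case 1
    have "((\<lambda>t. poly P (1 / t) * exp (- (1 / t))) has_real_derivative flat_poly (flat_step P) t) (at t)"
      using 1 by (auto intro!: derivative_eq_intros poly_DERIV[THEN DERIV_chain2]
          simp: flat_poly_def flat_step_def poly_monom field_simps power2_eq_square)
    then show ?thesis
      by (rule has_field_derivative_transform_within_open[of _ _ _ "{0<..}"])
         (use 1 in \<open>auto simp: flat_poly_def\<close>)
  next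
    case 2
    have "((\<lambda>t. 0) has_real_derivative flat_poly (flat_step P) t) (at t)"
      using 2 by (auto simp: flat_poly_def)
    then show ?thesis
      by (rule has_field_derivative_transform_within_open[of _ _ _ "{..<0}"])
         (use 2 in \<open>auto simp: flat_poly_def\<close>)
  next
    case 3
    \<comment> \<open>The difference quotient at 0 has for positive \<open>t\<close> the same form
      with \<open>P\<close> multiplied by X, and it is 0 for negative \<open>t\<close>. Substituting
      \<open>1 / t\<close> turns its limit into the decay of a polynomial against the exponential at
      infinity.\<close>
    have "((\<lambda>t. poly (monom 1 1 * P) (inverse t) * exp (- inverse t)) \<longlongrightarrow> 0) (at_right 0)"
      by (rule filterlim_compose[OF poly_div_exp_tendsto_0 filterlim_inverse_at_top_right])
    then have "((\<lambda>t. flat_poly P t / t) \<longlongrightarrow> 0) (at_right 0)"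
      by (rule Lim_transform_eventually)
         (auto simp: eventually_at_right_field flat_poly_def poly_monom field_simps intro!: exI[of _ 1])
    moreover have "((\<lambda>t. flat_poly P t / t) \<longlongrightarrow> 0) (at_left 0)"
      by (rule Lim_transform_eventually[of "\<lambda>_. 0"])
         (auto simp: eventually_at_left_field flat_poly_def intro!: exI[of _ "-1"])
    ultimately have "((\<lambda>t. flat_poly P t / t) \<longlongrightarrow> 0) (at 0)"
      by (simp add: filterlim_split_at_real)
    then show ?thesis
      unfolding has_field_derivative_iff 3 by (simp add: flat_poly_def)
  qed
qed

lemma smooth_real_on_flat_poly: "smooth_real_on UNIV (flat_poly P)"
  unfolding smooth_real_on_def
  by (intro exI[of _ "\<lambda>n. flat_poly ((flat_step ^^ n) P)"]) (auto intro: flat_poly_deriv)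

section \<open>Integration by parts\<close>

text \<open>By translation invariance the difference quotients of \<open>F\<close> in direction \<open>b\<close> have integral
  zero; no iterated integration is needed.\<close>

lemma integral_directional_derivative_eq_0:
  fixes F :: "'a::euclidean_space \<Rightarrow> real"
  assumes der: "\<And>x. (F has_derivative F' x) (at x)"
    and cont: "continuous_on UNIV (\<lambda>x. F' x b)"
    and K: "compact K" "\<And>x. x \<notin> K \<Longrightarrow> F x = 0"
  shows "(\<integral>x. F' x b \<partial>lborel) = 0"
proof -
  \<comment> \<open>Difference quotients along the steps \<open>1 / Suc n\<close>, which never
    exceed 1; this bounds all translates at once.\<close>
  define q where "q n x = real (Suc n) * (F (x + (1 / real (Suc n)) *\<^sub>R b) - F x)" for n x
  have contF: "continuous_on UNIV F"
    using der by (auto intro!: continuous_at_imp_continuous_on has_derivative_continuous)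
  have [measurable]: "F \<in> borel_measurable borel" "(\<lambda>x. F' x b) \<in> borel_measurable borel"
    using contF cont by (auto intro: borel_measurable_continuous_onI)
  have lineder: "((\<lambda>t. F (x + t *\<^sub>R b)) has_real_derivative F' (x + t *\<^sub>R b) b) (at t)" for x t
  proof -
    have "((\<lambda>t. x + t *\<^sub>R b) has_derivative (\<lambda>h. h *\<^sub>R b)) (at t)"
      by (auto intro!: derivative_eq_intros)
    from has_derivative_compose[OF this der]
    have "((\<lambda>t. F (x + t *\<^sub>R b)) has_derivative (\<lambda>h. F' (x + t *\<^sub>R b) (h *\<^sub>R b))) (at t)" .
    moreover have "F' (x + t *\<^sub>R b) (h *\<^sub>R b) = F' (x + t *\<^sub>R b) b * h" for h
      using linear_scale[OF has_derivative_linear[OF der]] by simp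
    ultimately show ?thesis by (simp add: has_field_derivative_def)
  qed
  \<comment> \<open>The complement of \<open>K\<close> is open and \<open>F\<close> vanishes on it,
    so \<open>F\<close> is locally constant there.\<close>
  have F'0: "F' x b = 0" if "x \<notin> K" for x
  proof -
    have "((\<lambda>_. 0) has_derivative F' x) (at x)"
      using has_derivative_transform_within_open[OF der, of "- K" x "\<lambda>_. 0"] K that compact_imp_closed
      by auto
    then show ?thesis
      using has_derivative_unique[of "\<lambda>_. 0::real" "F' x" x "\<lambda>_. 0"] by auto
  qed
  obtain M where M: "\<And>x. \<bar>F' x b\<bar> \<le> M"
  proof -
    have "bounded ((\<lambda>x. F' x b) ` K)"
      using K cont by (intro compact_imp_bounded compact_continuous_image)
        (auto intro: continuous_on_subset)
    then obtain M where "\<And>x. x \<in> K \<Longrightarrow> \<bar>F' x b\<bar> \<le> M"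
      unfolding bounded_iff by auto
    then have "\<bar>F' x b\<bar> \<le> max 0 M" for x
      using F'0[of x] by (cases "x \<in> K") (auto intro: max.coboundedI2)
    then show thesis by (rule that)
  qed
  \<comment> \<open>The mean value theorem on the segment from \<open>x\<close> in direction
    \<open>b\<close> bounds the quotients independently of \<open>n\<close>.\<close>
  have lip: "\<bar>F (x + t *\<^sub>R b) - F x\<bar> \<le> M * t" if t: "t > 0" for x t
  proof -
    obtain z where "F (x + t *\<^sub>R b) - F (x + 0 *\<^sub>R b) = (t - 0) * F' (x + z *\<^sub>R b) b"
      using MVT2[OF t, of "\<lambda>t. F (x + t *\<^sub>R b)" "\<lambda>t. F' (x + t *\<^sub>R b) b"] lineder by blast
    then show ?thesis using M[of "x + z *\<^sub>R b"] t
      by (simp add: abs_mult mult.commute mult_right_mono)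
  qed
  obtain R where R: "\<And>x. x \<in> K \<Longrightarrow> norm x \<le> R"
    using K compact_imp_bounded bounded_iff by metis
  \<comment> \<open>A ball outside which both \<open>x\<close> and its translates by at most
    \<open>norm b\<close> miss \<open>K\<close>, hence outside which every \<open>q n\<close> is 0.
    Its indicator times \<open>M\<close> is the dominating function.\<close>
  define C where "C = cball (0::'a) (R + norm b)"
  have qb: "norm (q n x) \<le> M * indicator C x" for n x
  proof (cases "x \<in> C")
    case True
    have "\<bar>q n x\<bar> = real (Suc n) * \<bar>F (x + (1 / real (Suc n)) *\<^sub>R b) - F x\<bar>"
      by (simp add: q_def abs_mult)
    also have "\<dots> \<le> real (Suc n) * (M * (1 / real (Suc n)))"
      by (intro mult_left_mono lip) auto
    also have "\<dots> = M" by (simp add: field_simps)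
    finally show ?thesis using True by simp
  next
    case False
    then have n: "norm x > R + norm b" by (simp add: C_def)
    then have "x \<notin> K" using R[of x] norm_ge_zero[of b] by linarith
    moreover have "x + (1 / real (Suc n)) *\<^sub>R b \<notin> K"
    proof
      assume "x + (1 / real (Suc n)) *\<^sub>R b \<in> K"
      from R[OF this] have "norm x - norm ((1 / real (Suc n)) *\<^sub>R b) \<le> R"
        using norm_diff_ineq[of x "(1 / real (Suc n)) *\<^sub>R b"] by linarith
      moreover have "norm ((1 / real (Suc n)) *\<^sub>R b) \<le> norm b"
        by (simp add: field_simps)
      ultimately show False using n by linarith
    qed
    ultimately show ?thesis using K False by (simp add: q_def)
  qed
  have qlim: "(\<lambda>n. q n x) \<longlonglongrightarrow> F' x b" for x
  proof -
    have "((\<lambda>t. (F (x + t *\<^sub>R b) - F x) / t) \<longlongrightarrow> F' x b) (at 0)"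
      using lineder[of x 0] unfolding has_field_derivative_iff by simp
    moreover have "filterlim (\<lambda>n. 1 / real (Suc n)) (at 0) sequentially"
      using LIMSEQ_inverse_real_of_nat by (simp add: filterlim_at inverse_eq_divide del: of_nat_Suc)
    ultimately have "((\<lambda>n. (F (x + (1 / real (Suc n)) *\<^sub>R b) - F x) / (1 / real (Suc n))) \<longlongrightarrow> F' x b) sequentially"
      by (rule filterlim_compose)
    then show ?thesis by (simp add: q_def mult.commute)
  qed
  have "integrable lborel (\<lambda>x. M * indicator C x)"
    unfolding C_def by (intro integrable_mult_right) (auto intro: integrable_real_indicator emeasure_lborel_cball_finite)
  moreover have "(\<lambda>x. q n x) \<in> borel_measurable lborel" for n
    unfolding q_def by measurable
  ultimately have lim: "(\<lambda>n. \<integral>x. q n x \<partial>lborel) \<longlonglongrightarrow> (\<integral>x. F' x b \<partial>lborel)"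
    using qlim qb by (intro integral_dominated_convergence[where w="\<lambda>x. M * indicator C x"]) auto
  have intF: "integrable lborel F"
  proof -
    have "integrable lborel (\<lambda>x. indicator K x *\<^sub>R F x)"
      using K contF by (intro borel_integrable_compact) (auto intro: continuous_on_subset)
    moreover have "(\<lambda>x. indicator K x *\<^sub>R F x) = F" using K by (auto simp: indicator_def fun_eq_iff)
    ultimately show ?thesis by simp
  qed
  have trans: "(\<integral>x. F (x + c) \<partial>lborel) = (\<integral>x. F x \<partial>lborel)" "integrable lborel (\<lambda>x. F (x + c))" for c
  proof -
    have "(\<integral>x. F x \<partial>lborel) = (\<integral>x. F x \<partial>distr lborel borel ((+) c))"
      by (simp add: lborel_distr_plus)
    also have "\<dots> = (\<integral>x. F (c + x) \<partial>lborel)" by (rule integral_distr) auto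
    finally show "(\<integral>x. F (x + c) \<partial>lborel) = (\<integral>x. F x \<partial>lborel)" by (simp add: add.commute)
    have "integrable (distr lborel borel ((+) c)) F" using intF by (simp add: lborel_distr_plus)
    then have "integrable lborel (\<lambda>x. F (c + x))" by (subst (asm) integrable_distr_eq) auto
    then show "integrable lborel (\<lambda>x. F (x + c))" by (simp add: add.commute)
  qed
  have "(\<integral>x. q n x \<partial>lborel) = 0" for n
    unfolding q_def using trans intF by (simp add: Bochner_Integration.integral_diff)
  with lim show ?thesis by (simp add: LIMSEQ_const_iff)
qed

section \<open>Test functions and integrals with compact support\<close>

lemma test_function_regularity:
  assumes "test_function \<Omega> \<phi>"
  shows "(\<phi> has_derivative frechet_derivative \<phi> (at x)) (at x)"
    and "continuous_on UNIV \<phi>"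
    and "continuous_on UNIV (grad \<phi>)"
    and "b \<in> Basis \<Longrightarrow> grad \<phi> x \<bullet> b = frechet_derivative \<phi> (at x) b"
proof -
  have Ck: "C_k k \<phi>" for k using assms by (simp add: test_function_def)
  show "(\<phi> has_derivative frechet_derivative \<phi> (at x)) (at x)"
    using Ck[of 1] by (simp add: frechet_derivative_works[symmetric])
  show "continuous_on UNIV \<phi>" using Ck[of 0] by simp
  have "continuous_on UNIV (\<lambda>x. frechet_derivative \<phi> (at x) b)" if "b \<in> Basis" for b
    using Ck[of "Suc 0"] that by simp
  then show "continuous_on UNIV (grad \<phi>)"
    unfolding grad_def[abs_def]
    by (intro continuous_on_sum continuous_on_scaleR continuous_on_const) auto
  show "grad \<phi> x \<bullet> b = frechet_derivative \<phi> (at x) b" if "b \<in> Basis"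
    using that by (simp add: grad_def inner_sum_left inner_Basis if_distrib cong: if_cong)
qed

lemma test_function_supportE:
  assumes "test_function \<Omega> \<phi>"
  obtains K where "compact K" "K \<subseteq> \<Omega>" "\<And>x. x \<notin> K \<Longrightarrow> \<phi> x = 0" "\<And>x. x \<notin> K \<Longrightarrow> grad \<phi> x = 0"
proof -
  define K where "K = closure {x. \<phi> x \<noteq> 0}"
  have K: "compact K" "K \<subseteq> \<Omega>" using assms by (auto simp: test_function_def K_def)
  have zero: "\<phi> x = 0" if "x \<notin> K" for x
    using that closure_subset[of "{x. \<phi> x \<noteq> 0}"] unfolding K_def by blast
  have "grad \<phi> x = 0" if "x \<notin> K" for x
  proof -
    have "((\<lambda>_. 0) has_derivative frechet_derivative \<phi> (at x)) (at x)"
      using has_derivative_transform_within_open[OF test_function_regularity(1)[OF assms], of "- K" x "\<lambda>_. 0"]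
        zero that K(1) compact_imp_closed by auto
    from has_derivative_unique[OF this has_derivative_const]
    have "frechet_derivative \<phi> (at x) = (\<lambda>_. 0)" .
    then show ?thesis by (simp add: grad_def)
  qed
  with K zero show thesis by (intro that)
qed

lemma set_integrable_lebesgue_compact:
  fixes h :: "'a::euclidean_space \<Rightarrow> 'b::euclidean_space"
  assumes "compact K" "continuous_on K h"
  shows "set_integrable lebesgue K h"
  unfolding set_integrable_def
  using borel_integrable_compact[OF assms] integrable_completion
  by (metis borel_measurable_integrable)

lemma set_integrable_lebesgue_compact_support:
  fixes h :: "'a::euclidean_space \<Rightarrow> 'b::euclidean_space"
  assumes "compact K" "K \<subseteq> \<Omega>" "continuous_on K h" "\<And>x. x \<notin> K \<Longrightarrow> h x = 0"
  shows "set_integrable lebesgue \<Omega> h"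
proof -
  have "(\<lambda>x. indicator \<Omega> x *\<^sub>R h x) = (\<lambda>x. indicator K x *\<^sub>R h x)"
    using assms(2,4) by (auto simp: indicator_def fun_eq_iff)
  then show ?thesis
    using set_integrable_lebesgue_compact[OF assms(1,3)] by (simp add: set_integrable_def)
qed

text \<open>Connects the weak formulation, stated over \<open>lebesgue\<close>, with the translation
  argument, carried out over \<open>lborel\<close>: for Borel functions the completion does not
  change the integral.\<close>

lemma set_integral_lebesgue_eq_lborel:
  fixes h :: "'a::euclidean_space \<Rightarrow> 'b::euclidean_space"
  assumes "continuous_on UNIV h" "\<And>x. x \<notin> \<Omega> \<Longrightarrow> h x = 0"
  shows "(LINT x:\<Omega>|lebesgue. h x) = (\<integral>x. h x \<partial>lborel)"
proof -
  have "(\<lambda>x. indicator \<Omega> x *\<^sub>R h x) = h"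
    using assms(2) by (auto simp: indicator_def fun_eq_iff)
  then show ?thesis
    using assms(1) by (simp add: set_lebesgue_integral_def integral_completion borel_measurable_continuous_onI)
qed

text \<open>The two integrands add up to the derivative of \<open>w * \<phi>\<close> in direction
  \<open>b\<close>. This product has compact support, so its derivative integrates to zero. Asking
  for no more than first derivatives of \<open>w\<close> admits powers of the norm, which need not
  be smooth at the origin.\<close>

lemma integration_by_parts:
  fixes w :: "'a::euclidean_space \<Rightarrow> real"
  assumes \<phi>: "test_function \<Omega> \<phi>" and b: "b \<in> Basis"
    and w: "\<And>x. (w has_derivative W x) (at x)" "continuous_on UNIV (\<lambda>x. W x b)"
  shows "(LINT x:\<Omega>|lebesgue. w x * (grad \<phi> x \<bullet> b)) = - (LINT x:\<Omega>|lebesgue. \<phi> x * W x b)"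
proof -
  note T = test_function_regularity[OF \<phi>]
  obtain K where K: "compact K" "K \<subseteq> \<Omega>" "\<And>x. x \<notin> K \<Longrightarrow> \<phi> x = 0" "\<And>x. x \<notin> K \<Longrightarrow> grad \<phi> x = 0"
    using test_function_supportE[OF \<phi>] by blast
  have cw: "continuous_on UNIV w"
    using w(1) by (auto intro!: continuous_at_imp_continuous_on has_derivative_continuous)
  have c1: "continuous_on UNIV (\<lambda>x. w x * (grad \<phi> x \<bullet> b))"
    and c2: "continuous_on UNIV (\<lambda>x. \<phi> x * W x b)"
    by (intro continuous_on_mult continuous_on_inner continuous_on_const cw T(2,3) w(2))+
  have i: "set_integrable lebesgue \<Omega> (\<lambda>x. w x * (grad \<phi> x \<bullet> b))"
    "set_integrable lebesgue \<Omega> (\<lambda>x. \<phi> x * W x b)"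
    using K c1 c2
    by (auto intro!: set_integrable_lebesgue_compact_support[of K] intro: continuous_on_subset)
  have sum_eq: "W x b * \<phi> x + w x * frechet_derivative \<phi> (at x) b = w x * (grad \<phi> x \<bullet> b) + \<phi> x * W x b" for x
    by (simp add: T(4)[OF b])
  have "((\<lambda>x. w x * \<phi> x) has_derivative (\<lambda>h. w x * frechet_derivative \<phi> (at x) h + W x h * \<phi> x)) (at x)" for x
    by (intro has_derivative_mult w T)
  then have "((\<lambda>x. w x * \<phi> x) has_derivative (\<lambda>h. W x h * \<phi> x + w x * frechet_derivative \<phi> (at x) h)) (at x)" for x
    by (simp add: add.commute)
  then have "(\<integral>x. W x b * \<phi> x + w x * frechet_derivative \<phi> (at x) b \<partial>lborel) = 0"
    by (rule integral_directional_derivative_eq_0[where K=K])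
       (use K c1 c2 in \<open>auto simp: sum_eq intro: continuous_on_add\<close>)
  moreover have "(LINT x:\<Omega>|lebesgue. w x * (grad \<phi> x \<bullet> b) + \<phi> x * W x b)
      = (\<integral>x. w x * (grad \<phi> x \<bullet> b) + \<phi> x * W x b \<partial>lborel)"
  proof (intro set_integral_lebesgue_eq_lborel continuous_on_add c1 c2)
    fix x assume "x \<notin> \<Omega>"
    then have "x \<notin> K" using K(2) by blast
    then show "w x * (grad \<phi> x \<bullet> b) + \<phi> x * W x b = 0" by (simp add: K)
  qed
  ultimately show ?thesis
    using set_integral_add(2)[OF i] by (simp add: sum_eq)
qed

section \<open>Sobolev regularity\<close>

lemma powr_norm_has_derivative:
  fixes x :: "'a::euclidean_space"
  assumes "\<theta> > 1"
  shows "((\<lambda>x. norm x powr \<theta>) has_derivative (\<lambda>h. \<theta> * norm x powr (\<theta> - 2) * (x \<bullet> h))) (at x)"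
proof (cases "x = 0")
  case True
  \<comment> \<open>At the origin the claimed derivative is zero because of the factor
    \<open>x\<close>, and the remainder divided by \<open>norm h\<close> is exactly this
    power.\<close>
  have "((\<lambda>h::'a. norm h powr (\<theta> - 1)) \<longlongrightarrow> 0) (at 0)"
    using assms by (intro tendsto_zero_powrI[where b="\<theta> - 1"] tendsto_norm_zero tendsto_ident_at tendsto_const) auto
  moreover have "norm (norm h powr \<theta>) / norm h = norm h powr (\<theta> - 1)" for h :: 'a
    by (cases "h = 0") (auto simp: powr_diff)
  ultimately show ?thesis
    using True assms by (simp add: has_derivative_at)
next
  case False
  have "((\<lambda>t. t powr \<theta>) has_derivative (\<lambda>h. h * (\<theta> * norm x powr (\<theta> - 1)))) (at (norm x))"
    using has_real_derivative_powr[of "norm x" \<theta>] False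
    by (simp add: has_field_derivative_def mult_commute_abs)
  from has_derivative_compose[OF has_derivative_norm[OF False] this]
  have *: "((\<lambda>x. norm x powr \<theta>) has_derivative (\<lambda>h. (h \<bullet> sgn x) * (\<theta> * norm x powr (\<theta> - 1)))) (at x)"
    by simp
  have "(h \<bullet> sgn x) * (\<theta> * norm x powr (\<theta> - 1)) = \<theta> * norm x powr (\<theta> - 2) * (x \<bullet> h)" for h
    using False powr_add[of "norm x" "\<theta> - 2" 1]
    by (simp add: sgn_div_norm inner_commute field_simps)
  with * show ?thesis by simp
qed

text \<open>For \<theta> below 2 the scalar factor blows up at the origin; the vector still tends to
  0, because its norm is \<open>norm x powr (\<theta> - 1)\<close>.\<close>

lemma continuous_powr_norm_scaleR:
  assumes "\<theta> > 1"
  shows "continuous_on UNIV (\<lambda>x::'a::euclidean_space. norm x powr (\<theta> - 2) *\<^sub>R x)"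
proof (rule continuous_at_imp_continuous_on, rule ballI)
  fix x :: 'a
  show "isCont (\<lambda>x. norm x powr (\<theta> - 2) *\<^sub>R x) x"
  proof (cases "x = 0")
    case True
    have "((\<lambda>h::'a. norm h powr (\<theta> - 1)) \<longlongrightarrow> 0) (at 0)"
      using assms by (intro tendsto_zero_powrI[where b="\<theta> - 1"] tendsto_norm_zero tendsto_ident_at tendsto_const) auto
    moreover have "norm h powr (\<theta> - 1) = norm (norm h powr (\<theta> - 2) *\<^sub>R h)" for h :: 'a
      using powr_add[of "norm h" "\<theta> - 2" 1] by (cases "h = 0") (auto simp: algebra_simps)
    ultimately have "((\<lambda>h::'a. norm h powr (\<theta> - 2) *\<^sub>R h) \<longlongrightarrow> 0) (at 0)"
      by (subst tendsto_norm_zero_iff[symmetric]) simp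
    then show ?thesis using True by (simp add: isCont_def)
  next
    case False
    then show ?thesis by (intro continuous_intros) auto
  qed
qed

lemma continuous_powr_norm:
  assumes "a > 0"
  shows "continuous_on S (\<lambda>x::'a::euclidean_space. norm x powr a)"
  using assms by (intro continuous_on_powr' continuous_intros) auto

definition u_grad :: "real \<Rightarrow> 'a::euclidean_space \<Rightarrow> 'a" where
  "u_grad \<theta> x = (- \<theta> * norm x powr (\<theta> - 2)) *\<^sub>R x"

lemma norm_u_grad:
  assumes "\<theta> > 0"
  shows "norm (u_grad \<theta> x) = \<theta> * norm x powr (\<theta> - 1)"
  using assms powr_add[of "norm x" "\<theta> - 2" 1]
  by (cases "x = 0") (auto simp: u_grad_def abs_mult)

lemma continuous_u_grad:
  assumes "\<theta> > 1"
  shows "continuous_on UNIV (u_grad \<theta>)"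
proof -
  have "continuous_on UNIV (\<lambda>x::'a. (- \<theta>) *\<^sub>R (norm x powr (\<theta> - 2) *\<^sub>R x))"
    by (intro continuous_on_scaleR continuous_on_const continuous_powr_norm_scaleR assms)
  then show ?thesis by (simp add: u_grad_def[abs_def])
qed

lemma u_fun_has_derivative:
  assumes "\<theta> > 1"
  shows "(u_fun \<theta> has_derivative (\<lambda>h. u_grad \<theta> x \<bullet> h)) (at x)"
proof -
  have "((\<lambda>x. 1 - norm x powr \<theta>) has_derivative (\<lambda>h. 0 - \<theta> * norm x powr (\<theta> - 2) * (x \<bullet> h))) (at x)"
    by (intro has_derivative_diff has_derivative_const powr_norm_has_derivative assms)
  then show ?thesis by (simp add: u_grad_def u_fun_def[abs_def])
qed

lemma continuous_u_fun:
  assumes "\<theta> > 0"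
  shows "continuous_on S (u_fun \<theta> :: 'a::euclidean_space \<Rightarrow> real)"
  unfolding u_fun_def[abs_def]
  using assms by (intro continuous_on_diff continuous_on_const continuous_powr_norm)

section \<open>Integrability, weak gradients and dominated convergence\<close>

lemma locally_integrable_on_continuous:
  "continuous_on \<Omega> f \<Longrightarrow> locally_integrable_on \<Omega> f"
  unfolding locally_integrable_on_def
  by (blast intro: set_integrable_lebesgue_compact continuous_on_subset)

lemma Lp_on_continuous:
  fixes f :: "'a::euclidean_space \<Rightarrow> 'b::euclidean_space"
  assumes "bounded \<Omega>" "open \<Omega>" "p > 0" "continuous_on UNIV f"
  shows "Lp_on p \<Omega> f"
  unfolding Lp_on_def
proof
  have "f \<in> borel_measurable lebesgue"
    using assms(4) by (intro measurable_completion) (simp add: borel_measurable_continuous_onI)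
  then show "set_borel_measurable lebesgue \<Omega> f"
    unfolding set_borel_measurable_def using assms(2) by (intro borel_measurable_scaleR borel_measurable_indicator) auto
  have "continuous_on (closure \<Omega>) (\<lambda>x. norm (f x) powr p)"
    using assms(3) continuous_on_subset[OF assms(4)]
    by (intro continuous_on_powr' continuous_on_norm continuous_on_const) auto
  then have "set_integrable lebesgue (closure \<Omega>) (\<lambda>x. norm (f x) powr p)"
    using assms(1) by (intro set_integrable_lebesgue_compact) (auto simp: compact_closure)
  then show "set_integrable lebesgue \<Omega> (\<lambda>x. norm (f x) powr p)"
    by (rule set_integrable_subset) (use assms(2) closure_subset in auto)
qed

text \<open>Integration by parts in each coordinate. Continuous differentiability is all that is
  asked, since \<open>u_fun\<close> may fail to be twice differentiable at the origin.\<close>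

lemma weak_gradient_has_derivative:
  fixes u :: "'a::euclidean_space \<Rightarrow> real"
  assumes u: "\<And>x. (u has_derivative (\<lambda>h. G x \<bullet> h)) (at x)" and G: "continuous_on UNIV G"
  shows "weak_gradient \<Omega> u G"
  unfolding weak_gradient_def
proof (intro conjI allI impI)
  have cu: "continuous_on UNIV u"
    using u by (auto intro!: continuous_at_imp_continuous_on has_derivative_continuous)
  show "locally_integrable_on \<Omega> u" "locally_integrable_on \<Omega> G"
    using cu G by (auto intro: locally_integrable_on_continuous continuous_on_subset)
  fix \<phi> :: "'a \<Rightarrow> real" assume \<phi>: "test_function \<Omega> \<phi>"
  note T = test_function_regularity[OF \<phi>]
  obtain K where K: "compact K" "K \<subseteq> \<Omega>" "\<And>x. x \<notin> K \<Longrightarrow> \<phi> x = 0" "\<And>x. x \<notin> K \<Longrightarrow> grad \<phi> x = 0"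
    using test_function_supportE[OF \<phi>] by blast
  have c: "continuous_on UNIV (\<lambda>x. u x *\<^sub>R grad \<phi> x)" "continuous_on UNIV (\<lambda>x. \<phi> x *\<^sub>R G x)"
    by (intro continuous_on_scaleR cu G T(2,3))+
  have i: "set_integrable lebesgue \<Omega> (\<lambda>x. u x *\<^sub>R grad \<phi> x)"
    "set_integrable lebesgue \<Omega> (\<lambda>x. \<phi> x *\<^sub>R G x)"
    using K c by (auto intro!: set_integrable_lebesgue_compact_support[of K] intro: continuous_on_subset)
  show "(LINT x:\<Omega>|lebesgue. u x *\<^sub>R grad \<phi> x) = - (LINT x:\<Omega>|lebesgue. \<phi> x *\<^sub>R G x)"
  proof (rule euclidean_eqI)
    fix b :: 'a assume b: "b \<in> Basis"
    have "(LINT x:\<Omega>|lebesgue. u x *\<^sub>R grad \<phi> x) \<bullet> b = (LINT x:\<Omega>|lebesgue. u x * (grad \<phi> x \<bullet> b))"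
      using i(1) by (simp add: set_lebesgue_integral_def set_integrable_def mult.assoc flip: integral_inner_left)
    also have "\<dots> = - (LINT x:\<Omega>|lebesgue. \<phi> x * (G x \<bullet> b))"
      by (intro integration_by_parts \<phi> b u continuous_on_inner G continuous_on_const)
    also have "\<dots> = (- (LINT x:\<Omega>|lebesgue. \<phi> x *\<^sub>R G x)) \<bullet> b"
      using i(2) by (simp add: set_lebesgue_integral_def set_integrable_def mult.assoc flip: integral_inner_left)
    finally show "(LINT x:\<Omega>|lebesgue. u x *\<^sub>R grad \<phi> x) \<bullet> b = (- (LINT x:\<Omega>|lebesgue. \<phi> x *\<^sub>R G x)) \<bullet> b" .
  qed
qed

text \<open>Dominated convergence with the constant \<open>M powr p\<close> on a set of finite
  measure; it serves both the functions and their gradients in \<open>W0_u_fun\<close>.\<close>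

lemma set_integral_powr_tendsto_0:
  fixes w :: "nat \<Rightarrow> 'a::euclidean_space \<Rightarrow> 'b::euclidean_space"
  assumes \<Omega>: "bounded \<Omega>" "open \<Omega>" and p: "p > 0"
    and meas: "\<And>n. w n \<in> borel_measurable borel"
    and bnd: "\<And>n x. x \<in> \<Omega> \<Longrightarrow> norm (w n x) \<le> M"
    and lim: "\<And>x. x \<in> \<Omega> \<Longrightarrow> (\<lambda>n. w n x) \<longlonglongrightarrow> 0"
  shows "(\<lambda>n. LINT x:\<Omega>|lebesgue. norm (w n x) powr p) \<longlonglongrightarrow> 0"
proof -
  have "(\<lambda>n. LINT x|lebesgue. indicator \<Omega> x *\<^sub>R (norm (w n x) powr p)) \<longlonglongrightarrow> (LINT x::'a|lebesgue. (0::real))"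
  proof (rule integral_dominated_convergence[where w="\<lambda>x::'a. M powr p * indicator \<Omega> x"])
    have [measurable]: "w n \<in> borel_measurable lebesgue" for n
      using meas by (intro measurable_completion) simp
    have [measurable]: "\<Omega> \<in> sets lebesgue" using \<Omega> by auto
    show "(\<lambda>x. indicator \<Omega> x *\<^sub>R (norm (w n x) powr p)) \<in> borel_measurable lebesgue" for n
      by measurable
    have "\<Omega> \<in> lmeasurable" using \<Omega> by (simp add: bounded_set_imp_lmeasurable)
    then show "integrable lebesgue (\<lambda>x::'a. M powr p * indicator \<Omega> x)"
      by (intro integrable_mult_right) (auto simp: fmeasurable_def integrable_indicator_iff)
    show "AE x in lebesgue. (\<lambda>n. indicator \<Omega> x *\<^sub>R (norm (w n x) powr p)) \<longlonglongrightarrow> 0"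
    proof (intro always_eventually allI)
      fix x
      show "(\<lambda>n. indicator \<Omega> x *\<^sub>R (norm (w n x) powr p)) \<longlonglongrightarrow> 0"
      proof (cases "x \<in> \<Omega>")
        case True
        have "(\<lambda>n. norm (w n x) powr p) \<longlonglongrightarrow> 0"
          using p by (intro tendsto_zero_powrI[where b=p] tendsto_norm_zero lim True tendsto_const) auto
        then show ?thesis using True by simp
      qed simp
    qed
    show "AE x in lebesgue. norm (indicator \<Omega> x *\<^sub>R (norm (w n x) powr p)) \<le> M powr p * indicator \<Omega> x" for n
      using bnd[of _ n] p by (auto simp: indicator_def intro!: powr_mono2)
  qed auto
  then show ?thesis by (simp add: set_lebesgue_integral_def)
qed

text \<open>\<open>slope\<close> is the derivative of \<open>t exp (-1/t)\<close>, see \<open>truncation_deriv\<close>.\<close>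

definition slope :: "real \<Rightarrow> real" where
  "slope t = (if t > 0 then (1 + 1 / t) * exp (- (1 / t)) else 0)"

text \<open>The upper bound is \<open>1 + y \<le> exp y\<close> at \<open>y = 1 / t\<close>. It
  keeps the gradients of the truncations bounded independently of \<epsilon>.\<close>

lemma slope_bounds: "0 \<le> slope t" "slope t \<le> 1"
proof -
  show "0 \<le> slope t" by (simp add: slope_def)
  have "(1 + 1 / t) * exp (- (1 / t)) \<le> exp (1 / t) * exp (- (1 / t))"
    by (intro mult_right_mono exp_ge_add_one_self) simp
  then show "slope t \<le> 1"
    by (simp add: slope_def exp_minus_inverse)
qed

lemma flat_poly_1_bounds: "0 \<le> flat_poly 1 t" "flat_poly 1 t \<le> 1"
  by (auto simp: flat_poly_def)

text \<open>The function \<open>s exp (- \<epsilon> / s)\<close>, zero for \<open>s \<le> 0\<close>,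
  is a smooth substitute for the positive part of \<open>s\<close>; its derivative depends on
  \<open>s / \<epsilon>\<close> alone.\<close>

lemma truncation_deriv:
  assumes "\<epsilon> > 0"
  shows "((\<lambda>s. s * flat_poly 1 (s / \<epsilon>)) has_real_derivative slope (s / \<epsilon>)) (at s)"
proof -
  have "((\<lambda>s. s / \<epsilon>) has_real_derivative 1 / \<epsilon>) (at s)"
    using DERIV_cdivide[OF DERIV_ident] by blast
  from DERIV_chain2[OF flat_poly_deriv this, of 1]
  have "((\<lambda>s. s * flat_poly 1 (s / \<epsilon>)) has_real_derivative
      1 * flat_poly 1 (s / \<epsilon>) + flat_poly (flat_step 1) (s / \<epsilon>) * (1 / \<epsilon>) * s) (at s)"
    by (intro DERIV_mult DERIV_ident)
  \<comment> \<open>\<open>flat_step 1\<close> is X squared, so the second summand is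
    \<open>(1 / t) exp (- (1 / t))\<close> for positive \<open>t\<close>.\<close>
  moreover have "flat_poly 1 t + flat_poly (flat_step 1) t * t = slope t" for t
    by (simp add: flat_poly_def flat_step_def slope_def poly_monom power2_eq_square algebra_simps)
  from this[of "s / \<epsilon>"]
  have "1 * flat_poly 1 (s / \<epsilon>) + flat_poly (flat_step 1) (s / \<epsilon>) * (1 / \<epsilon>) * s = slope (s / \<epsilon>)" by simp
  ultimately show ?thesis by simp
qed

text \<open>Once \<open>s n\<close> is positive, both expressions are continuous functions of
  \<open>e n / s n\<close>, which tends to 0.\<close>

lemma flat_poly_1_slope_tendsto_1:
  assumes "s \<longlonglongrightarrow> l" "l > 0" "e \<longlonglongrightarrow> 0" "\<And>n. e n > (0::real)"
  shows "(\<lambda>n. flat_poly 1 (s n / e n)) \<longlonglongrightarrow> 1" "(\<lambda>n. slope (s n / e n)) \<longlonglongrightarrow> 1"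
proof -
  have pos: "eventually (\<lambda>n. s n > 0) sequentially"
    using order_tendstoD(1)[OF assms(1,2)] .
  have q: "(\<lambda>n. e n / s n) \<longlonglongrightarrow> 0 / l"
    using assms by (intro tendsto_divide) auto
  have "(\<lambda>n. exp (- (e n / s n))) \<longlonglongrightarrow> exp (- (0 / l))"
    by (intro tendsto_exp tendsto_minus q)
  then have "(\<lambda>n. exp (- (e n / s n))) \<longlonglongrightarrow> 1" by simp
  then show "(\<lambda>n. flat_poly 1 (s n / e n)) \<longlonglongrightarrow> 1"
    by (rule Lim_transform_eventually)
       (use pos assms(4) in \<open>auto simp: flat_poly_def elim!: eventually_mono\<close>)
  have "(\<lambda>n. (1 + e n / s n) * exp (- (e n / s n))) \<longlonglongrightarrow> (1 + 0 / l) * exp (- (0 / l))"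
    by (intro tendsto_mult tendsto_add tendsto_const tendsto_exp tendsto_minus q)
  then have "(\<lambda>n. (1 + e n / s n) * exp (- (e n / s n))) \<longlonglongrightarrow> 1" by simp
  then show "(\<lambda>n. slope (s n / e n)) \<longlonglongrightarrow> 1"
    by (rule Lim_transform_eventually)
       (use pos assms(4) in \<open>auto simp: slope_def elim!: eventually_mono\<close>)
qed

section \<open>Smooth approximations supported inside the ball\<close>

definition regularization :: "real \<Rightarrow> real \<Rightarrow> 'a::euclidean_space \<Rightarrow> real" where
  "regularization \<theta> \<epsilon> x = 1 - \<epsilon> - ((norm x)\<^sup>2 + \<epsilon>) powr (\<theta> / 2)"

definition truncated_regularization :: "real \<Rightarrow> real \<Rightarrow> 'a::euclidean_space \<Rightarrow> real" where
  "truncated_regularization \<theta> \<epsilon> x = regularization \<theta> \<epsilon> x * flat_poly 1 (regularization \<theta> \<epsilon> x / \<epsilon>)"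

lemma regularization_has_derivative:
  fixes x :: "'a::euclidean_space"
  assumes "\<epsilon> > 0"
  shows "(regularization \<theta> \<epsilon> has_derivative
    (\<lambda>h. ((- \<theta> * ((norm x)\<^sup>2 + \<epsilon>) powr (\<theta> / 2 - 1)) *\<^sub>R x) \<bullet> h)) (at x)"
proof -
  have pos: "(norm x)\<^sup>2 + \<epsilon> > 0" using assms by (simp add: add_nonneg_pos)
  have "((\<lambda>x. (norm x)\<^sup>2 + \<epsilon>) has_derivative (\<lambda>h. 2 * (x \<bullet> h))) (at x)"
    unfolding power2_norm_eq_inner
    by (auto intro!: derivative_eq_intros simp: inner_commute)
  moreover have "((\<lambda>t. t powr (\<theta> / 2)) has_derivative
      (\<lambda>h. h * (\<theta> / 2 * ((norm x)\<^sup>2 + \<epsilon>) powr (\<theta> / 2 - 1)))) (at ((norm x)\<^sup>2 + \<epsilon>))"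
    using has_real_derivative_powr[OF pos, of "\<theta> / 2"]
    unfolding has_field_derivative_def by (rule has_derivative_eq_rhs) (simp add: fun_eq_iff)
  ultimately have "((\<lambda>x. ((norm x)\<^sup>2 + \<epsilon>) powr (\<theta> / 2)) has_derivative
      (\<lambda>h. 2 * (x \<bullet> h) * (\<theta> / 2 * ((norm x)\<^sup>2 + \<epsilon>) powr (\<theta> / 2 - 1)))) (at x)"
    by (rule has_derivative_compose)
  then have "((\<lambda>x. 1 - \<epsilon> - ((norm x)\<^sup>2 + \<epsilon>) powr (\<theta> / 2)) has_derivative
      (\<lambda>h. 0 - 2 * (x \<bullet> h) * (\<theta> / 2 * ((norm x)\<^sup>2 + \<epsilon>) powr (\<theta> / 2 - 1)))) (at x)"
    by (intro has_derivative_diff has_derivative_const)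
  then show ?thesis
    by (simp add: regularization_def[abs_def] algebra_simps)
qed

lemma grad_eqI:
  assumes "(f has_derivative (\<lambda>h. g \<bullet> h)) (at x)"
  shows "grad f x = g"
proof -
  have "frechet_derivative f (at x) = (\<lambda>h. g \<bullet> h)"
    using frechet_derivative_at[OF assms] by simp
  then show ?thesis by (simp add: grad_def euclidean_representation)
qed

lemma grad_truncated_regularization:
  fixes x :: "'a::euclidean_space"
  assumes "\<epsilon> > 0"
  shows "grad (truncated_regularization \<theta> \<epsilon>) x = 
    (slope (regularization \<theta> \<epsilon> x / \<epsilon>) * (- \<theta> * ((norm x)\<^sup>2 + \<epsilon>) powr (\<theta> / 2 - 1))) *\<^sub>R x"
proof (rule grad_eqI)
  have "((\<lambda>s. s * flat_poly 1 (s / \<epsilon>)) has_derivative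
      (\<lambda>h. h * slope (regularization \<theta> \<epsilon> x / \<epsilon>))) (at (regularization \<theta> \<epsilon> x))"
    using truncation_deriv[OF assms] by (simp add: has_field_derivative_def mult_commute_abs)
  from has_derivative_compose[OF regularization_has_derivative[OF assms] this]
  show "(truncated_regularization \<theta> \<epsilon> has_derivative (\<lambda>h. ((slope (regularization \<theta> \<epsilon> x / \<epsilon>) *
      (- \<theta> * ((norm x)\<^sup>2 + \<epsilon>) powr (\<theta> / 2 - 1))) *\<^sub>R x) \<bullet> h)) (at x)"
    by (simp add: truncated_regularization_def[abs_def] algebra_simps)
qed

text \<open>A base of at least 1 would make the value at most \<open>- \<epsilon>\<close>. The bound
  confines the supports to a smaller closed ball and also feeds the gradient estimate.\<close>

lemma regularization_pos_imp:
  fixes x :: "'a::euclidean_space"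
  assumes "\<epsilon> > 0" "\<theta> > 0" "regularization \<theta> \<epsilon> x > 0"
  shows "(norm x)\<^sup>2 + \<epsilon> < 1"
proof (rule ccontr)
  assume "\<not> ?thesis"
  then have "((norm x)\<^sup>2 + \<epsilon>) powr (\<theta> / 2) \<ge> 1"
    using assms(2) by (intro ge_one_powr_ge_zero) auto
  then show False using assms by (simp add: regularization_def)
qed

lemma truncated_regularization_bounds:
  assumes "\<epsilon> > 0"
  shows "0 \<le> truncated_regularization \<theta> \<epsilon> x" "truncated_regularization \<theta> \<epsilon> x \<le> 1"
proof -
  let ?f = "regularization \<theta> \<epsilon> x"
  have "0 \<le> truncated_regularization \<theta> \<epsilon> x \<and> truncated_regularization \<theta> \<epsilon> x \<le> 1"
  proof (cases "?f > 0")
    case True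
    moreover have "?f \<le> 1"
      using assms powr_ge_zero[of "(norm x)\<^sup>2 + \<epsilon>" "\<theta> / 2"] unfolding regularization_def by linarith
    ultimately show ?thesis
      using flat_poly_1_bounds[of "?f / \<epsilon>"] by (auto simp: truncated_regularization_def intro: mult_le_one)
  next
    case False
    then have "\<not> ?f / \<epsilon> > 0" using assms by (simp add: field_simps)
    then show ?thesis by (simp add: truncated_regularization_def flat_poly_def)
  qed
  then show "0 \<le> truncated_regularization \<theta> \<epsilon> x" "truncated_regularization \<theta> \<epsilon> x \<le> 1" by auto
qed

lemma norm_grad_truncated_regularization:
  assumes "\<epsilon> > 0" "\<theta> > 1"
  shows "norm (grad (truncated_regularization \<theta> \<epsilon>) x) \<le> \<theta>"
proof -
  let ?f = "regularization \<theta> \<epsilon> x" and ?q = "(norm x)\<^sup>2 + \<epsilon>"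
  have n: "norm (grad (truncated_regularization \<theta> \<epsilon>) x) = \<theta> * (slope (?f / \<epsilon>) * (?q powr (\<theta> / 2 - 1) * norm x))"
    using assms slope_bounds(1)[of "?f / \<epsilon>"]
    by (simp add: grad_truncated_regularization abs_mult)
  show ?thesis
  proof (cases "?f > 0")
    case True
    have q: "0 < ?q" "?q < 1"
      using regularization_pos_imp[of \<epsilon> \<theta> x] True assms by (auto simp: add_nonneg_pos)
    \<comment> \<open>Absorbing \<open>norm x\<close> into a half power of \<open>?q\<close> turns
      the exponent \<open>\<theta> / 2 - 1\<close>, possibly negative, into the positive
      \<open>(\<theta> - 1) / 2\<close>; then \<open>?q < 1\<close> bounds the power by 1.\<close>
    have "norm x \<le> ?q powr (1 / 2)"
      using assms q by (simp add: powr_half_sqrt real_le_rsqrt)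
    then have "?q powr (\<theta> / 2 - 1) * norm x \<le> ?q powr (\<theta> / 2 - 1) * ?q powr (1 / 2)"
      by (intro mult_left_mono) auto
    also have "\<dots> = ?q powr ((\<theta> - 1) / 2)"
      by (simp add: diff_divide_distrib flip: powr_add)
    also have "\<dots> \<le> 1"
      using q assms by (intro powr_le1) auto
    finally have "slope (?f / \<epsilon>) * (?q powr (\<theta> / 2 - 1) * norm x) \<le> 1"
      using slope_bounds[of "?f / \<epsilon>"] by - (rule mult_le_one, auto)
    from mult_left_mono[OF this, of \<theta>] show ?thesis using n assms by simp
  next
    case False
    then have "\<not> ?f / \<epsilon> > 0" using assms by (simp add: field_simps)
    then show ?thesis using n assms by (simp add: slope_def)
  qed
qed

lemma test_function_truncated_regularization:
  assumes "\<epsilon> > 0" "\<theta> > 0"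
  shows "test_function (ball 0 1) (truncated_regularization \<theta> \<epsilon> :: 'a::euclidean_space \<Rightarrow> real)"
  unfolding test_function_def
proof (intro conjI allI)
  have "smooth (\<lambda>x::'a. ((norm x)\<^sup>2 + \<epsilon>) powr (\<theta> / 2))"
    by (rule smooth_chain[OF smooth_real_on_powr smooth_add[OF smooth_norm_power2 smooth_const]])
       (use assms in \<open>auto simp: add_nonneg_pos\<close>)
  then have r: "smooth (\<lambda>x::'a. (1 - \<epsilon>) + (-1) * ((norm x)\<^sup>2 + \<epsilon>) powr (\<theta> / 2))"
    by (intro smooth_add smooth_mult smooth_const)
  then have r: "smooth (regularization \<theta> \<epsilon> :: 'a \<Rightarrow> real)"
    by (simp add: regularization_def[abs_def])
  \<comment> \<open>Division by \<epsilon> is written as multiplication by a constant to fit the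
    rules generating \<open>smooth\<close>.\<close>
  have "smooth (\<lambda>x::'a. regularization \<theta> \<epsilon> x * flat_poly 1 (regularization \<theta> \<epsilon> x * (1 / \<epsilon>)))"
    by (intro smooth_mult r smooth_chain[OF smooth_real_on_flat_poly] smooth_const) auto
  then have "smooth (truncated_regularization \<theta> \<epsilon> :: 'a \<Rightarrow> real)"
    by (simp add: truncated_regularization_def[abs_def])
  then show "C_k k (truncated_regularization \<theta> \<epsilon> :: 'a \<Rightarrow> real)" for k
    by (rule smooth_imp_C_k)
  have sub: "{x::'a. truncated_regularization \<theta> \<epsilon> x \<noteq> 0} \<subseteq> cball 0 (sqrt (1 - \<epsilon>))"
  proof
    fix x :: 'a assume "x \<in> {x. truncated_regularization \<theta> \<epsilon> x \<noteq> 0}"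
    then have "regularization \<theta> \<epsilon> x > 0"
      using assms by (auto simp: truncated_regularization_def flat_poly_def zero_less_divide_iff split: if_splits)
    from regularization_pos_imp[OF assms this] have "(norm x)\<^sup>2 \<le> 1 - \<epsilon>" by simp
    then show "x \<in> cball 0 (sqrt (1 - \<epsilon>))" by (simp add: real_le_rsqrt)
  qed
  then have cl: "closure {x::'a. truncated_regularization \<theta> \<epsilon> x \<noteq> 0} \<subseteq> cball 0 (sqrt (1 - \<epsilon>))"
    by (intro closure_minimal) auto
  then show "compact (closure {x::'a. truncated_regularization \<theta> \<epsilon> x \<noteq> 0})"
    using bounded_subset[OF bounded_cball] by (auto simp: compact_eq_bounded_closed)
  show "closure {x::'a. truncated_regularization \<theta> \<epsilon> x \<noteq> 0} \<subseteq> ball 0 1"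
    using cl assms by (fastforce intro: le_less_trans[of _ "sqrt (1 - \<epsilon>)" 1])
qed

lemma W0_u_fun:
  assumes \<theta>: "\<theta> > 1" and p: "p > 0"
  shows "W0_with_gradient p (ball 0 1) (u_fun \<theta> :: 'a::euclidean_space \<Rightarrow> real) (u_grad \<theta>)"
  unfolding W0_with_gradient_def
proof (intro conjI)
  let ?B = "ball (0::'a) 1"
  let ?u = "u_fun \<theta> :: 'a \<Rightarrow> real"
  show "weak_gradient ?B ?u (u_grad \<theta>)"
    by (intro weak_gradient_has_derivative u_fun_has_derivative continuous_u_grad \<theta>)
  show "Lp_on p ?B ?u" "Lp_on p ?B (u_grad \<theta>)"
    using \<theta> p by (auto intro!: Lp_on_continuous continuous_u_fun continuous_u_grad)
  \<comment> \<open>Any positive null sequence would serve.\<close>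
  define e where "e n = 1 / real (n + 2)" for n
  have e: "e n > 0" for n by (simp add: e_def)
  have e0: "e \<longlonglongrightarrow> 0"
    using LIMSEQ_ignore_initial_segment[OF lim_1_over_n, of 2] by (simp add: e_def[abs_def])
  define \<phi> where "\<phi> n = (truncated_regularization \<theta> (e n) :: 'a \<Rightarrow> real)" for n
  have T: "test_function ?B (\<phi> n)" for n
    unfolding \<phi>_def using \<theta> by (intro test_function_truncated_regularization e) auto
  \<comment> \<open>A power with exponent \<open>c \<le> 0\<close> is not continuous at base 0,
    hence the alternative in the premise. The gradient needs \<open>c = \<theta> / 2 - 1\<close>, so
    there the origin is treated apart: all gradients vanish at it.\<close>
  have qlim: "(\<lambda>n. ((norm x)\<^sup>2 + e n) powr c) \<longlonglongrightarrow> ((norm x)\<^sup>2) powr c" if "x \<noteq> 0 \<or> c > 0" for x :: 'a and c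
    using tendsto_add[OF tendsto_const e0, of "(norm x)\<^sup>2"] that
    by (intro tendsto_powr' tendsto_const) (auto intro!: always_eventually add_nonneg_nonneg less_imp_le[OF e])
  have norm_sq_powr: "((norm x)\<^sup>2) powr (c / 2) = norm x powr c" for x :: 'a and c
    by (cases "x = 0") (auto simp: powr_powr simp flip: powr_numeral)
  have rlim: "(\<lambda>n. regularization \<theta> (e n) x) \<longlonglongrightarrow> ?u x" for x
  proof -
    have "(\<lambda>n. 1 - e n - ((norm x)\<^sup>2 + e n) powr (\<theta> / 2)) \<longlonglongrightarrow> 1 - 0 - ((norm x)\<^sup>2) powr (\<theta> / 2)"
      using \<theta> by (intro tendsto_diff tendsto_const e0 qlim) auto
    then show ?thesis by (simp add: regularization_def u_fun_def norm_sq_powr)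
  qed
  have upos: "?u x > 0" if "x \<in> ?B" for x
    using that \<theta> powr_less_mono2[of \<theta> "norm x" 1] by (cases "x = 0") (auto simp: u_fun_def)
  note flim = flat_poly_1_slope_tendsto_1[OF rlim upos e0 e]
  have ulim: "(\<lambda>n. \<phi> n x) \<longlonglongrightarrow> ?u x" if "x \<in> ?B" for x
    using tendsto_mult[OF rlim[of x] flim(1)[OF that]] by (simp add: \<phi>_def truncated_regularization_def)
  have glim: "(\<lambda>n. grad (\<phi> n) x) \<longlonglongrightarrow> u_grad \<theta> x" if "x \<in> ?B" for x
  proof (cases "x = 0")
    case False
    have "(\<lambda>n. (slope (regularization \<theta> (e n) x / e n) * (- \<theta> * ((norm x)\<^sup>2 + e n) powr (\<theta> / 2 - 1))) *\<^sub>R x)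
        \<longlonglongrightarrow> (1 * (- \<theta> * ((norm x)\<^sup>2) powr (\<theta> / 2 - 1))) *\<^sub>R x"
      using False by (intro tendsto_scaleR tendsto_mult tendsto_const flim(2) that qlim) auto
    moreover have "((norm x)\<^sup>2) powr (\<theta> / 2 - 1) = norm x powr (\<theta> - 2)"
      using norm_sq_powr[of x "\<theta> - 2"] by (simp add: diff_divide_distrib)
    ultimately show ?thesis
      by (simp add: \<phi>_def grad_truncated_regularization e u_grad_def)
  qed (simp add: \<phi>_def grad_truncated_regularization e u_grad_def)
  show "\<exists>\<phi>::nat \<Rightarrow> 'a \<Rightarrow> real. (\<forall>n. test_function ?B (\<phi> n)) \<and>
      (\<lambda>n. LINT x:?B|lebesgue. \<bar>\<phi> n x - ?u x\<bar> powr p) \<longlonglongrightarrow> 0 \<and>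
      (\<lambda>n. LINT x:?B|lebesgue. norm (grad (\<phi> n) x - u_grad \<theta> x) powr p) \<longlonglongrightarrow> 0"
  proof (intro exI[of _ \<phi>] conjI allI T)
    have "(\<lambda>n. LINT x:?B|lebesgue. norm (\<phi> n x - ?u x) powr p) \<longlonglongrightarrow> 0"
    proof (rule set_integral_powr_tendsto_0[where M=1])
      show "(\<lambda>x. \<phi> n x - ?u x) \<in> borel_measurable borel" for n
        using \<theta> by (intro borel_measurable_diff borel_measurable_continuous_onI continuous_u_fun
            test_function_regularity(2)[OF T]) auto
      show "norm (\<phi> n x - ?u x) \<le> 1" if "x \<in> ?B" for n x
        using upos[OF that] truncated_regularization_bounds[OF e, of \<theta> n x] powr_ge_zero[of "norm x" \<theta>]
        by (auto simp: \<phi>_def u_fun_def abs_le_iff simp del: powr_ge_zero)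
      show "(\<lambda>n. \<phi> n x - ?u x) \<longlonglongrightarrow> 0" if "x \<in> ?B" for x
        using tendsto_diff[OF ulim[OF that] tendsto_const[of "?u x"]] by simp
    qed (use p in auto)
    then show "(\<lambda>n. LINT x:?B|lebesgue. \<bar>\<phi> n x - ?u x\<bar> powr p) \<longlonglongrightarrow> 0" by simp
    show "(\<lambda>n. LINT x:?B|lebesgue. norm (grad (\<phi> n) x - u_grad \<theta> x) powr p) \<longlonglongrightarrow> 0"
    \<comment> \<open>Both the approximating gradients and the limit gradient have norm at most
      \<theta> in the ball.\<close>
    proof (rule set_integral_powr_tendsto_0[where M="\<theta> + \<theta>"])
      show "(\<lambda>x. grad (\<phi> n) x - u_grad \<theta> x) \<in> borel_measurable borel" for n
        by (intro borel_measurable_diff borel_measurable_continuous_onI continuous_u_grad \<theta>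
            test_function_regularity(3)[OF T])
      show "norm (grad (\<phi> n) x - u_grad \<theta> x) \<le> \<theta> + \<theta>" if "x \<in> ?B" for n x
      proof -
        have "norm (grad (\<phi> n) x) \<le> \<theta>"
          unfolding \<phi>_def by (intro norm_grad_truncated_regularization e \<theta>)
        moreover have "norm x powr (\<theta> - 1) \<le> 1"
          using that \<theta> by (intro powr_le1) auto
        then have "norm (u_grad \<theta> x) \<le> \<theta>"
          using \<theta> by (simp add: norm_u_grad)
        ultimately show ?thesis
          using norm_triangle_ineq4[of "grad (\<phi> n) x" "u_grad \<theta> x"] by linarith
      qed
      show "(\<lambda>n. grad (\<phi> n) x - u_grad \<theta> x) \<longlonglongrightarrow> 0" if "x \<in> ?B" for x
        using tendsto_diff[OF glim[OF that] tendsto_const[of "u_grad \<theta> x"]] by simp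
    qed (use p in auto)
  qed
qed

section \<open>The counterexample\<close>

lemma u_fun_pos:
  fixes x :: "'a::euclidean_space"
  assumes "\<theta> > 0" "x \<in> ball 0 1"
  shows "1 - norm x powr \<theta> > 0"
  using assms powr_less_mono2[of \<theta> "norm x" 1] by auto

text \<open>The exponents add up as \<open>(\<theta> - 1) * (p - 2) + (\<theta> - 2) = (p - 1) *
  (\<theta> - 1) - 1\<close>.\<close>

lemma u_grad_flux:
  assumes "\<theta> > 1"
  shows "norm (u_grad \<theta> x) powr (p - 2) * (u_grad \<theta> x \<bullet> y)
    = - (\<theta> powr (p - 1)) * (norm x powr ((p - 1) * (\<theta> - 1) - 1) * (x \<bullet> y))"
proof (cases "x = 0")
  case False
  have "norm x powr ((\<theta> - 1) * (p - 2)) * norm x powr (\<theta> - 2) = norm x powr ((p - 1) * (\<theta> - 1) - 1)"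
    by (simp add: algebra_simps flip: powr_add)
  moreover have "\<theta> powr (p - 2) * \<theta> = \<theta> powr (p - 1)"
    using assms powr_add[of \<theta> "p - 2" 1] by simp
  moreover have "norm (u_grad \<theta> x) powr (p - 2) * (u_grad \<theta> x \<bullet> y)
      = - (\<theta> powr (p - 2) * \<theta>) * ((norm x powr ((\<theta> - 1) * (p - 2)) * norm x powr (\<theta> - 2)) * (x \<bullet> y))"
    using assms norm_u_grad[of \<theta> x] by (simp add: powr_mult powr_powr) (simp add: u_grad_def)
  ultimately show ?thesis by simp
qed (simp add: u_grad_def)

text \<open>The divergence of \<open>|x|^a x\<close> is \<open>(a + N) |x|^a\<close> in dimension N;
  each component of the field is integrated by parts separately.\<close>

lemma integral_powr_norm_inner_grad:
  fixes \<phi> :: "'a::euclidean_space \<Rightarrow> real"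
  assumes \<phi>: "test_function \<Omega> \<phi>" and a: "a > 1"
  shows "(LINT x:\<Omega>|lebesgue. norm x powr a * (x \<bullet> grad \<phi> x))
    = - (LINT x:\<Omega>|lebesgue. (a + real DIM('a)) * norm x powr a * \<phi> x)"
proof -
  note T = test_function_regularity[OF \<phi>]
  obtain K where K: "compact K" "K \<subseteq> \<Omega>" "\<And>x. x \<notin> K \<Longrightarrow> \<phi> x = 0" "\<And>x. x \<notin> K \<Longrightarrow> grad \<phi> x = 0"
    using test_function_supportE[OF \<phi>] by blast
  \<comment> \<open>\<open>W b x\<close> is the derivative at \<open>x\<close> of the component of
    the field along \<open>b\<close>, so the sum of \<open>W b x b\<close> over \<open>Basis\<close>
    is the divergence.\<close>
  define W where "W b x h = norm x powr a * (h \<bullet> b) + a * norm x powr (a - 2) * (x \<bullet> h) * (x \<bullet> b)" for b x h :: 'a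
  have W: "((\<lambda>x. norm x powr a * (x \<bullet> b)) has_derivative W b x) (at x)" for b x :: 'a
    unfolding W_def
    by (intro has_derivative_mult powr_norm_has_derivative a has_derivative_inner_left has_derivative_ident)
  have cW: "continuous_on UNIV (\<lambda>x. W b x b)" for b
  proof -
    have "continuous_on UNIV (\<lambda>x. norm x powr a * (b \<bullet> b) + a * ((norm x powr (a - 2) *\<^sub>R x) \<bullet> b) * (x \<bullet> b))"
      using a by (intro continuous_on_add continuous_on_mult continuous_on_inner continuous_on_const
          continuous_on_id continuous_powr_norm continuous_powr_norm_scaleR) auto
    then show ?thesis by (simp add: W_def mult.assoc)
  qed
  have i1: "set_integrable lebesgue \<Omega> (\<lambda>x. norm x powr a * (x \<bullet> b) * (grad \<phi> x \<bullet> b))" for b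
    using a K by (intro set_integrable_lebesgue_compact_support[of K] continuous_on_mult continuous_on_inner
        continuous_on_const continuous_on_id continuous_powr_norm continuous_on_subset[OF T(3)]) auto
  have i2: "set_integrable lebesgue \<Omega> (\<lambda>x. \<phi> x * W b x b)" for b
    using K by (intro set_integrable_lebesgue_compact_support[of K] continuous_on_mult
        continuous_on_subset[OF T(2)] continuous_on_subset[OF cW]) auto
  have sum_integral: "(LINT x:\<Omega>|lebesgue. (\<Sum>b\<in>Basis. g b x)) = (\<Sum>b\<in>Basis. LINT x:\<Omega>|lebesgue. g b x)"
    if "\<And>b. set_integrable lebesgue \<Omega> (g b)" for g :: "'a \<Rightarrow> 'a \<Rightarrow> real"
    unfolding set_lebesgue_integral_def scaleR_sum_right
    by (intro Bochner_Integration.integral_sum that[unfolded set_integrable_def])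
  have div: "(\<Sum>b\<in>Basis. W b x b) = (a + real DIM('a)) * norm x powr a" for x
  proof -
    have "(\<Sum>b\<in>Basis. W b x b) = (\<Sum>b\<in>(Basis::'a set). norm x powr a) + a * norm x powr (a - 2) * (\<Sum>b\<in>Basis. (x \<bullet> b) * (x \<bullet> b))"
      by (simp add: W_def sum.distrib sum_distrib_left mult.assoc)
    also have "(\<Sum>b\<in>Basis. (x \<bullet> b) * (x \<bullet> b)) = (norm x)\<^sup>2"
      by (simp add: power2_norm_eq_inner flip: euclidean_inner)
    also have "a * norm x powr (a - 2) * (norm x)\<^sup>2 = a * norm x powr a"
      using powr_add[of "norm x" "a - 2" 2] by (cases "x = 0") auto
    finally show ?thesis by (simp add: algebra_simps)
  qed
  have "(LINT x:\<Omega>|lebesgue. norm x powr a * (x \<bullet> grad \<phi> x))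
      = (LINT x:\<Omega>|lebesgue. (\<Sum>b\<in>Basis. norm x powr a * (x \<bullet> b) * (grad \<phi> x \<bullet> b)))"
    by (simp add: euclidean_inner[of _ "grad \<phi> _"] sum_distrib_left mult.assoc)
  also have "\<dots> = (\<Sum>b\<in>Basis. LINT x:\<Omega>|lebesgue. norm x powr a * (x \<bullet> b) * (grad \<phi> x \<bullet> b))"
    by (rule sum_integral[OF i1])
  also have "\<dots> = (\<Sum>b\<in>Basis. - (LINT x:\<Omega>|lebesgue. \<phi> x * W b x b))"
    by (intro sum.cong refl integration_by_parts \<phi> W cW)
  also have "\<dots> = - (LINT x:\<Omega>|lebesgue. (\<Sum>b\<in>Basis. \<phi> x * W b x b))"
    by (simp only: sum_integral[OF i2] sum_negf)
  also have "\<dots> = - (LINT x:\<Omega>|lebesgue. (a + real DIM('a)) * norm x powr a * \<phi> x)"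
    by (simp add: div mult_ac flip: sum_distrib_left)
  finally show ?thesis .
qed

lemma continuous_u_fun_powr:
  assumes "\<theta> > 0"
  shows "continuous_on (ball 0 1) (\<lambda>x::'a::euclidean_space. (1 - norm x powr \<theta>) powr c)"
proof (rule continuous_on_powr)
  show "continuous_on (ball 0 1) (\<lambda>x::'a. 1 - norm x powr \<theta>)"
    using assms by (intro continuous_on_diff continuous_on_const continuous_powr_norm)
  show "\<forall>x\<in>ball (0::'a) 1. 1 - norm x powr \<theta> \<noteq> 0"
    using u_fun_pos[OF assms] by fastforce
qed simp

lemma continuous_f_fun:
  assumes "\<theta> > 0" "(p - 1) * (\<theta> - 1) - 1 > 0"
  shows "continuous_on (ball 0 1) (f_fun p \<delta> lam \<theta> :: 'a::euclidean_space \<Rightarrow> real)"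
  unfolding f_fun_def[abs_def]
  using assms by (intro continuous_on_diff continuous_on_mult continuous_on_const
      continuous_powr_norm continuous_u_fun_powr)

text \<open>Compact subsets of the open ball stay away from the sphere, so the singular terms,
  continuous inside, are locally integrable. What remains is the identity for the flux.\<close>

lemma positive_weak_solution_u_fun:
  assumes \<theta>: "\<theta> > 1" and p: "p > 2" and a: "(p - 1) * (\<theta> - 1) - 1 > 1"
  shows "positive_weak_solution p \<delta> lam (ball 0 1) (f_fun p \<delta> lam \<theta>) (u_fun \<theta> :: 'a::euclidean_space \<Rightarrow> real)"
  unfolding positive_weak_solution_def
proof (intro conjI exI[of _ "u_grad \<theta>"] allI impI)
  let ?B = "ball (0::'a) 1"
  show "continuous_on (closure ?B) (u_fun \<theta>)" using \<theta> by (intro continuous_u_fun) auto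
  show "\<forall>x\<in>?B. 0 < u_fun \<theta> x" using u_fun_pos[of \<theta>] \<theta> by (auto simp: u_fun_def)
  show "\<forall>x\<in>frontier ?B. u_fun \<theta> x = 0" by (auto simp: u_fun_def)
  have cu: "continuous_on ?B (\<lambda>x. u_fun \<theta> x powr c)" for c
    using \<theta> continuous_u_fun_powr[of \<theta> c] by (simp add: u_fun_def)
  have cf: "continuous_on ?B (f_fun p \<delta> lam \<theta>)"
    using \<theta> a by (intro continuous_f_fun) auto
  show "locally_integrable_on ?B (\<lambda>x. u_fun \<theta> x powr (- \<delta>))"
    "locally_integrable_on ?B (f_fun p \<delta> lam \<theta>)"
    by (intro locally_integrable_on_continuous cu cf)+
  show "W0_with_gradient p ?B (u_fun \<theta>) (u_grad \<theta>)"
    using \<theta> p by (intro W0_u_fun) auto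
  fix \<phi> :: "'a \<Rightarrow> real" assume \<phi>: "test_function ?B \<phi>"
  note T = test_function_regularity[OF \<phi>]
  obtain K where K: "compact K" "K \<subseteq> ?B" "\<And>x. x \<notin> K \<Longrightarrow> \<phi> x = 0" "\<And>x. x \<notin> K \<Longrightarrow> grad \<phi> x = 0"
    using test_function_supportE[OF \<phi>] by blast
  have int: "set_integrable lebesgue ?B (\<lambda>x. g x * \<phi> x)" if "continuous_on ?B g" for g
    using K by (intro set_integrable_lebesgue_compact_support[of K] continuous_on_mult
        continuous_on_subset[OF that] continuous_on_subset[OF T(2)]) auto
  define a where "a = (p - 1) * (\<theta> - 1) - 1"
  have a1: "a > 1" using a by (simp add: a_def)
  \<comment> \<open>\<open>h\<close> is \<open>- \<Delta>_p u\<close> computed classically, the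
    regular part of \<open>f_fun\<close>; the singular part cancels against the singular term of the
    equation.\<close>
  define h where "h x = \<theta> powr (p - 1) * ((a + real DIM('a)) * norm x powr a)" for x :: 'a
  have ch: "continuous_on ?B h"
    unfolding h_def using a1 by (intro continuous_on_mult continuous_on_const continuous_powr_norm) auto
  have f: "f_fun p \<delta> lam \<theta> x * \<phi> x = h x * \<phi> x - lam * (u_fun \<theta> x powr (- \<delta>) * \<phi> x)" for x
    by (simp add: f_fun_def h_def a_def u_fun_def algebra_simps)
  have "(LINT x:?B|lebesgue. norm (u_grad \<theta> x) powr (p - 2) * (u_grad \<theta> x \<bullet> grad \<phi> x))
      = (LINT x:?B|lebesgue. - (\<theta> powr (p - 1)) * (norm x powr a * (x \<bullet> grad \<phi> x)))"
    unfolding a_def by (simp only: u_grad_flux[OF \<theta>])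
  also have "\<dots> = - (\<theta> powr (p - 1)) * (LINT x:?B|lebesgue. norm x powr a * (x \<bullet> grad \<phi> x))"
    by (rule set_integral_mult_right)
  also have "\<dots> = \<theta> powr (p - 1) * (LINT x:?B|lebesgue. (a + real DIM('a)) * norm x powr a * \<phi> x)"
    using integral_powr_norm_inner_grad[OF \<phi> a1] by simp
  also have "\<dots> = (LINT x:?B|lebesgue. h x * \<phi> x)"
    by (simp add: h_def mult.assoc flip: set_integral_mult_right)
  finally have flux: "(LINT x:?B|lebesgue. norm (u_grad \<theta> x) powr (p - 2) * (u_grad \<theta> x \<bullet> grad \<phi> x))
      = (LINT x:?B|lebesgue. h x * \<phi> x)" .
  have "(LINT x:?B|lebesgue. f_fun p \<delta> lam \<theta> x * \<phi> x)
      = (LINT x:?B|lebesgue. h x * \<phi> x) - (LINT x:?B|lebesgue. lam * (u_fun \<theta> x powr (- \<delta>) * \<phi> x))"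
    unfolding f by (intro set_integral_diff(2) int ch set_integrable_mult_right cu)
  then show "(LINT x:?B|lebesgue. norm (u_grad \<theta> x) powr (p - 2) * (u_grad \<theta> x \<bullet> grad \<phi> x))
      - lam * (LINT x:?B|lebesgue. u_fun \<theta> x powr (- \<delta>) * \<phi> x) = (LINT x:?B|lebesgue. f_fun p \<delta> lam \<theta> x * \<phi> x)"
    by (simp add: flux set_integral_mult_right)
qed

section \<open>Comparison of the right-hand sides\<close>

lemma one_minus_powr_le:
  assumes "0 \<le> (s::real)" "s \<le> 1" "q \<ge> 1"
  shows "1 - s powr q \<le> q * (1 - s)"
proof -
  \<comment> \<open>In the interior the mean value theorem applies, with derivative at most
    \<open>q\<close> below 1. The derivative rule wants a positive base, and at \<open>s = 1\<close>
    the interval degenerates, so the endpoints are separate.\<close>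
  consider "s = 0" | "s = 1" | "0 < s" "s < 1" using assms by linarith
  then show ?thesis
  proof cases
    case 3
    have "((\<lambda>t. t powr q) has_real_derivative q * t powr (q - 1)) (at t)" if "s \<le> t" for t
      using 3 that by (intro has_real_derivative_powr) auto
    then obtain z where z: "s < z" "z < 1" "1 powr q - s powr q = (1 - s) * (q * z powr (q - 1))"
      using MVT2[OF 3(2), of "\<lambda>t. t powr q" "\<lambda>t. q * t powr (q - 1)"] by blast
    have "z powr (q - 1) \<le> 1" using z 3 assms by (intro powr_le1) auto
    then have "(1 - s) * (q * z powr (q - 1)) \<le> (1 - s) * (q * 1)"
      using 3 assms by (intro mult_left_mono) auto
    then show ?thesis using z by (simp add: mult.commute)
  qed (use assms in auto)
qed

text \<open>Mean value theorem: on the interval the derivative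
  \<open>\<delta> * (1 - t) powr (- \<delta> - 1)\<close> is at least \<delta>. It is applied to the
  two powers of \<open>r\<close>, the one with the smaller exponent as \<open>a\<close>.\<close>

lemma powr_neg_diff_ge:
  assumes "0 \<le> b" "b \<le> a" "a < (1::real)" "0 < \<delta>"
  shows "(1 - a) powr (- \<delta>) - (1 - b) powr (- \<delta>) \<ge> \<delta> * (a - b)"
proof (cases "a = b")
  case False
  then have ab: "b < a" using assms by simp
  have der: "((\<lambda>t. (1 - t) powr (- \<delta>)) has_real_derivative \<delta> * (1 - t) powr (- \<delta> - 1)) (at t)"
    if "t \<le> a" for t
    using that assms by (auto intro!: derivative_eq_intros)
  obtain z where z: "b < z" "z < a"
    "(1 - a) powr (- \<delta>) - (1 - b) powr (- \<delta>) = (a - b) * (\<delta> * (1 - z) powr (- \<delta> - 1))"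
    using MVT2[OF ab, of "\<lambda>t. (1 - t) powr (- \<delta>)" "\<lambda>t. \<delta> * (1 - t) powr (- \<delta> - 1)"] der by blast
  have "(1 - z) powr (- \<delta> - 1) \<ge> 1"
    using z assms powr_mono'[of "- \<delta> - 1" 0 "1 - z"] by simp
  then have "\<delta> * (a - b) * 1 \<le> \<delta> * (a - b) * (1 - z) powr (- \<delta> - 1)"
    using assms by (intro mult_left_mono) auto
  then show ?thesis using z by (simp add: mult_ac)
qed simp

text \<open>The threshold for \<open>lam\<close> does not depend on \<open>x\<close>. The origin is
  left out because both sides equal \<open>- lam\<close> there.\<close>

lemma f_fun_strict_mono:
  fixes x :: "'a::euclidean_space"
  assumes p: "p > 2" and \<delta>: "0 < \<delta>" and \<theta>: "p / (p - 2) \<le> \<theta>\<^sub>1" "\<theta>\<^sub>1 < \<theta>\<^sub>2"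
    and x: "x \<in> ball 0 1" "x \<noteq> 0"
    and lam: "lam > (p - 1) * (((p - 1) * (\<theta>\<^sub>1 - 1) - 1 + real DIM('a)) * \<theta>\<^sub>1 powr (p - 1)) / \<delta>"
  shows "f_fun p \<delta> lam \<theta>\<^sub>1 x < f_fun p \<delta> lam \<theta>\<^sub>2 x"
proof -
  define r where "r = norm x"
  have r: "0 < r" "r < 1" using x by (auto simp: r_def)
  define a where "a \<theta> = (p - 1) * (\<theta> - 1) - 1" for \<theta>
  define c where "c \<theta> = (a \<theta> + real DIM('a)) * \<theta> powr (p - 1)" for \<theta>
  have "p \<le> \<theta>\<^sub>1 * (p - 2)" using \<theta> p by (simp add: pos_divide_le_eq)
  then have a1: "\<theta>\<^sub>1 \<le> a \<theta>\<^sub>1" by (simp add: a_def algebra_simps)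
  have "1 < p / (p - 2)" using p by simp
  then have \<theta>1: "\<theta>\<^sub>1 > 1" using \<theta> by linarith
  have a12: "a \<theta>\<^sub>2 = a \<theta>\<^sub>1 + (\<theta>\<^sub>2 - \<theta>\<^sub>1) * (p - 1)" by (simp add: a_def algebra_simps)
  then have "a \<theta>\<^sub>1 \<le> a \<theta>\<^sub>2" using \<theta> p by simp
  then have c12: "0 \<le> c \<theta>\<^sub>1" "c \<theta>\<^sub>1 \<le> c \<theta>\<^sub>2"
    using a1 \<theta>1 \<theta> p by (auto simp: c_def intro!: mult_mono powr_mono2)
  define s where "s = r powr (\<theta>\<^sub>2 - \<theta>\<^sub>1)"
  have s: "0 \<le> s" "s < 1" using r \<theta> powr_less_mono2[of "\<theta>\<^sub>2 - \<theta>\<^sub>1" r 1] by (auto simp: s_def)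
  \<comment> \<open>The exponents \<open>a \<theta>\<close> differ by \<open>p - 1\<close> times the
    difference of the \<theta>, so both ratios are powers of the single quantity
    \<open>s\<close>.\<close>
  have rs: "r powr \<theta>\<^sub>2 = r powr \<theta>\<^sub>1 * s" "r powr a \<theta>\<^sub>2 = r powr a \<theta>\<^sub>1 * s powr (p - 1)"
    unfolding s_def a12 by (simp_all add: powr_powr flip: powr_add)
  have pos: "r powr \<theta>\<^sub>1 * (1 - s) > 0" using r s by simp
  have "c \<theta>\<^sub>1 * r powr a \<theta>\<^sub>1 - c \<theta>\<^sub>2 * r powr a \<theta>\<^sub>2 \<le> c \<theta>\<^sub>1 * r powr a \<theta>\<^sub>1 - c \<theta>\<^sub>1 * r powr a \<theta>\<^sub>2"
    using c12 by (simp add: mult_right_mono)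
  also have "\<dots> = c \<theta>\<^sub>1 * (r powr a \<theta>\<^sub>1 * (1 - s powr (p - 1)))"
    by (simp add: rs algebra_simps)
  \<comment> \<open>Since \<open>r < 1\<close>, the larger exponent
    \<open>a \<theta>\<^sub>1\<close> may be lowered to \<open>\<theta>\<^sub>1\<close>; the other
    factor is estimated by \<open>one_minus_powr_le\<close> with \<open>q = p - 1\<close>.\<close>
  also have "\<dots> \<le> c \<theta>\<^sub>1 * (r powr \<theta>\<^sub>1 * ((p - 1) * (1 - s)))"
    using c12 r a1 p s by (intro mult_left_mono mult_mono one_minus_powr_le powr_mono') (auto intro: powr_le1)
  also have "\<dots> = (p - 1) * c \<theta>\<^sub>1 * (r powr \<theta>\<^sub>1 * (1 - s))" by simp
  \<comment> \<open>The only use of the size of \<open>lam\<close>; strictness relies on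
    \<open>pos\<close>, that is on \<open>x\<close> being nonzero.\<close>
  also have "\<dots> < lam * \<delta> * (r powr \<theta>\<^sub>1 * (1 - s))"
    using lam \<delta> pos by (intro mult_strict_right_mono) (auto simp: c_def a_def field_simps)
  also have "\<dots> = lam * (\<delta> * (r powr \<theta>\<^sub>1 - r powr \<theta>\<^sub>2))" by (simp add: rs algebra_simps)
  also have "\<dots> \<le> lam * ((1 - r powr \<theta>\<^sub>1) powr (- \<delta>) - (1 - r powr \<theta>\<^sub>2) powr (- \<delta>))"
  proof (intro mult_left_mono powr_neg_diff_ge \<delta>)
    show "r powr \<theta>\<^sub>1 < 1" using r \<theta>1 powr_less_mono2[of \<theta>\<^sub>1 r 1] by simp
    show "r powr \<theta>\<^sub>2 \<le> r powr \<theta>\<^sub>1" using r \<theta> by (intro powr_mono') auto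
    \<comment> \<open>The threshold is itself nonnegative, hence so is \<open>lam\<close>.\<close>
    have "0 \<le> (p - 1) * c \<theta>\<^sub>1 / \<delta>" using p \<delta> c12 by simp
    then show "0 \<le> lam" using lam by (simp add: c_def a_def)
  qed auto
  finally show ?thesis by (simp add: f_fun_def c_def a_def r_def algebra_simps)
qed

theorem mainTheorem3:
  fixes p \<delta> \<theta>\<^sub>1 \<theta>\<^sub>2 :: real and B :: "(real ^ 'n) set"
  assumes "p > 2" and "0 < \<delta>" and "\<delta> < 1"
    and "p / (p - 2) \<le> \<theta>\<^sub>1" and "\<theta>\<^sub>1 < \<theta>\<^sub>2"
    and "B = ball 0 1"
  shows "\<forall>\<^sub>F lam in at_top.
    (\<forall>\<theta>\<in>{\<theta>\<^sub>1, \<theta>\<^sub>2}.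
       continuous_on B (f_fun p \<delta> lam \<theta>) \<and> radial_on B (f_fun p \<delta> lam \<theta>) \<and>
       positive_weak_solution p \<delta> lam B (f_fun p \<delta> lam \<theta>) (u_fun \<theta>) \<and>
       radially_decreasing_on B (u_fun \<theta>)) \<and>
    (\<forall>x\<in>B. f_fun p \<delta> lam \<theta>\<^sub>1 x \<le> f_fun p \<delta> lam \<theta>\<^sub>2 x) \<and>
    (\<exists>x\<in>B. f_fun p \<delta> lam \<theta>\<^sub>1 x \<noteq> f_fun p \<delta> lam \<theta>\<^sub>2 x) \<and>
    (\<forall>x\<in>B - {0}. u_fun \<theta>\<^sub>1 x < u_fun \<theta>\<^sub>2 x) \<and>
    u_fun \<theta>\<^sub>1 (0 :: real ^ 'n) = 1 \<and> u_fun \<theta>\<^sub>2 (0 :: real ^ 'n) = 1 \<and>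
    \<not> strong_comparison_principle p \<delta> lam B"
proof -
  let ?L = "(p - 1) * (((p - 1) * (\<theta>\<^sub>1 - 1) - 1 + real DIM(real ^ 'n)) * \<theta>\<^sub>1 powr (p - 1)) / \<delta>"
  have B: "B = ball 0 1" by fact
  have exponents: "\<theta> > 1 \<and> (p - 1) * (\<theta> - 1) - 1 > 1" if "p / (p - 2) \<le> \<theta>" for \<theta>
  proof -
    have "1 < p / (p - 2)" using assms(1) by simp
    moreover have "p \<le> \<theta> * (p - 2)" using that assms(1) by (simp add: pos_divide_le_eq)
    \<comment> \<open>The second fact rearranges to
      \<open>\<theta> \<le> (p - 1) * (\<theta> - 1) - 1\<close>, and \<theta> exceeds 1.\<close>
    ultimately show ?thesis using that by (simp add: algebra_simps)
  qed
  have \<theta>: "\<theta> > 1 \<and> (p - 1) * (\<theta> - 1) - 1 > 1" if "\<theta> \<in> {\<theta>\<^sub>1, \<theta>\<^sub>2}" for \<theta>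
    using that assms by (intro exponents) auto
  have u0: "u_fun \<theta> (0 :: real ^ 'n) = 1" for \<theta> by (simp add: u_fun_def)
  have radial: "radial_on B (f_fun p \<delta> lam \<theta>)" for lam \<theta>
    unfolding radial_on_def f_fun_def
    by (intro exI[of _ "\<lambda>r. ((p - 1) * (\<theta> - 1) - 1 + real DIM(real ^ 'n)) * \<theta> powr (p - 1) *
       r powr ((p - 1) * (\<theta> - 1) - 1) - lam * (1 - r powr \<theta>) powr (- \<delta>)"]) auto
  have decreasing: "radially_decreasing_on B (u_fun \<theta>)" if "\<theta> \<in> {\<theta>\<^sub>1, \<theta>\<^sub>2}" for \<theta>
    unfolding radially_decreasing_on_def u_fun_def using \<theta>[OF that]
    by (intro exI[of _ "\<lambda>r. 1 - r powr \<theta>"]) (auto intro!: powr_less_mono2)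
  have "eventually (\<lambda>lam. lam > ?L) at_top" by (rule eventually_gt_at_top)
  then show ?thesis
  proof (rule eventually_mono)
    fix lam assume lam: "lam > ?L"
    have cont: "continuous_on B (f_fun p \<delta> lam \<theta>)" if "\<theta> \<in> {\<theta>\<^sub>1, \<theta>\<^sub>2}" for \<theta>
      unfolding B using \<theta>[OF that] by (intro continuous_f_fun) auto
    have sol: "positive_weak_solution p \<delta> lam B (f_fun p \<delta> lam \<theta>) (u_fun \<theta>)" if "\<theta> \<in> {\<theta>\<^sub>1, \<theta>\<^sub>2}" for \<theta>
      unfolding B using \<theta>[OF that] assms(1) by (intro positive_weak_solution_u_fun) auto
    have less: "f_fun p \<delta> lam \<theta>\<^sub>1 x < f_fun p \<delta> lam \<theta>\<^sub>2 x" if "x \<in> B" "x \<noteq> 0" for x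
      using that lam assms by (intro f_fun_strict_mono) auto
    have le: "\<forall>x\<in>B. f_fun p \<delta> lam \<theta>\<^sub>1 x \<le> f_fun p \<delta> lam \<theta>\<^sub>2 x"
    proof
      fix x assume "x \<in> B"
      then show "f_fun p \<delta> lam \<theta>\<^sub>1 x \<le> f_fun p \<delta> lam \<theta>\<^sub>2 x"
        using less[of x] by (cases "x = 0") (auto simp: f_fun_def[of _ _ _ _ 0] less_imp_le)
    qed
    have neq: "\<exists>x\<in>B. f_fun p \<delta> lam \<theta>\<^sub>1 x \<noteq> f_fun p \<delta> lam \<theta>\<^sub>2 x"
    proof -
      \<comment> \<open>Any point of the ball other than the origin would do.\<close>
      obtain y :: "real ^ 'n" where "norm y = 1 / 2" using vector_choose_size[of "1 / 2"] by auto
      then have "y \<in> B" "y \<noteq> 0" by (auto simp: B)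
      with less show ?thesis by (metis less_irrefl)
    qed
    have u_less: "\<forall>x\<in>B - {0}. u_fun \<theta>\<^sub>1 x < u_fun \<theta>\<^sub>2 x"
      \<comment> \<open>For a base strictly between 0 and 1 the power strictly decreases in the
        exponent.\<close>
      using assms by (auto simp: u_fun_def B intro!: powr_less_mono')
    have "\<not> strong_comparison_principle p \<delta> lam B"
    proof
      assume "strong_comparison_principle p \<delta> lam B"
      then have "\<forall>x\<in>B. u_fun \<theta>\<^sub>1 x < u_fun \<theta>\<^sub>2 x"
        unfolding strong_comparison_principle_def
        using cont radial le neq sol decreasing by blast
      \<comment> \<open>The principle is contradicted only at the origin, where both solutions
        attain the value 1.\<close>
      then have "u_fun \<theta>\<^sub>1 (0 :: real ^ 'n) < u_fun \<theta>\<^sub>2 (0 :: real ^ 'n)" by (simp add: B)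
      then show False by (simp add: u0)
    qed
    then show "(\<forall>\<theta>\<in>{\<theta>\<^sub>1, \<theta>\<^sub>2}.
       continuous_on B (f_fun p \<delta> lam \<theta>) \<and> radial_on B (f_fun p \<delta> lam \<theta>) \<and>
       positive_weak_solution p \<delta> lam B (f_fun p \<delta> lam \<theta>) (u_fun \<theta>) \<and>
       radially_decreasing_on B (u_fun \<theta>)) \<and>
    (\<forall>x\<in>B. f_fun p \<delta> lam \<theta>\<^sub>1 x \<le> f_fun p \<delta> lam \<theta>\<^sub>2 x) \<and>
    (\<exists>x\<in>B. f_fun p \<delta> lam \<theta>\<^sub>1 x \<noteq> f_fun p \<delta> lam \<theta>\<^sub>2 x) \<and>
    (\<forall>x\<in>B - {0}. u_fun \<theta>\<^sub>1 x < u_fun \<theta>\<^sub>2 x) \<and>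
    u_fun \<theta>\<^sub>1 (0 :: real ^ 'n) = 1 \<and> u_fun \<theta>\<^sub>2 (0 :: real ^ 'n) = 1 \<and>
    \<not> strong_comparison_principle p \<delta> lam B"
      using cont radial le neq sol decreasing u_less u0 by blast
  qed
qed

end
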